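(* Let $k\ge 3$ and $m\ge 5$. Among all linear bicyclic $k$-uniform hypergraphs with $m$ edges, a hypergraph with maximum spectral radius is one of the three hypergraphs $B_m^L(1)$, $B_m^L(2)$, $B_m^P$, defined as follows. Let $G_5$ be the $k$-uniform hypergraph with $4$ edges consisting of an edge $e$ containing three distinct vertices $v_1,v_2,v_3$, a vertex $w\notin e$, and three edges $f_1,f_2,f_3$ with $f_i\cap e=\{v_i\}$, $f_i\cap f_j=\{w\}$ for $i\ne j$, all other vertices having degree one (so $w$ has degree $3$ and $v_1,v_2,v_3$ have degree $2$). $B_m^L(1)$ (resp. $B_m^L(2)$) is obtained from $G_5$ by attaching a hyperstar with $m-4$ edges with its center at $w$ (resp. at $v_1$). $B_m^P:=H_m^k$, where $H_m$ is the simple graph obtained from $K_4-e$ (the complete graph on 4 vertices minus one edge) by attaching a star $K_{1,m-5}$ with its center at a vertex of degree $3$.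
   Context: A $k$-uniform hypergraph $G=(V,E)$ has finite vertex set $V$ and edge set $E\subseteq\binom{V}{k}$. The degree of a vertex is the number of edges containing it. A walk is an alternating sequence $v_0e_1v_1\cdots e_lv_l$ with $\{v_{i-1},v_i\}\subseteq e_i$; $G$ is connected if every two vertices are joined by a walk. The cyclomatic number of a $k$-uniform hypergraph with $n$ vertices, $m$ edges and $l$ connected components is $m(k-1)-n+l$; a connected hypergraph is bicyclic if its cyclomatic number is $2$. $G$ is linear if any two distinct edges share at most one vertex. A hyperstar with $r$ edges and center $u$ consists of $r$ edges any two of which intersect exactly in $\{u\}$; attaching it at a vertex means its other vertices are new. For a simple graph $H=(V,E)$, its $k$-th power $H^k$ is obtained by adding, for each edge $e\in E$, $k-2$ new vertices and replacing $e$ by $e$ together with them. If $V=\{v_1,\dots,v_n\}$, the adjacency tensor $\mathcal{A}(G)$ has entries $a_{i_1\cdots i_k}=\frac{1}{(k-1)!}$ if $\{v_{i_1},\dots,v_{i_k}\}\in E$ and $0$ otherwise; $\lambda\in\mathbb{C}$ is an eigenvalue if there is a nonzero $x\in\mathbb{C}^n$ with $\sum_{i_2,\dots,i_k}a_{ii_2\cdots i_k}x_{i_2}\cdots x_{i_k}=\lambda x_i^{k-1}$ for all $i$; the spectral radius is the maximum modulus of the eigenvalues. *)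

theory Defs
  imports Complex_Main
begin

record 'a hypergraph =
  hverts :: "'a set"
  hedges :: "'a set set"

definition uniform_hypergraph :: "nat \<Rightarrow> 'a hypergraph \<Rightarrow> bool" where
  "uniform_hypergraph k G \<longleftrightarrow>
     finite (hverts G) \<and> hedges G \<subseteq> {e. e \<subseteq> hverts G \<and> card e = k}"

definition hdegree :: "'a hypergraph \<Rightarrow> 'a \<Rightarrow> nat" where
  "hdegree G v = card {e \<in> hedges G. v \<in> e}"

definition linear_hypergraph :: "'a hypergraph \<Rightarrow> bool" where
  "linear_hypergraph G \<longleftrightarrow>
     (\<forall>e\<in>hedges G. \<forall>f\<in>hedges G. e \<noteq> f \<longrightarrow> card (e \<inter> f) \<le> 1)"

text \<open>The walk \<open>v\<^sub>0 e\<^sub>1 v\<^sub>1 \<dots> e\<^sub>l v\<^sub>l\<close> is given by the lists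
  \<open>vs = [v\<^sub>0, \<dots>, v\<^sub>l]\<close> and \<open>es = [e\<^sub>1, \<dots>, e\<^sub>l]\<close>.\<close>

definition is_walk :: "'a hypergraph \<Rightarrow> 'a list \<Rightarrow> 'a set list \<Rightarrow> bool" where
  "is_walk G vs es \<longleftrightarrow>
     length vs = Suc (length es) \<and> set vs \<subseteq> hverts G \<and> set es \<subseteq> hedges G \<and>
     (\<forall>i<length es. {vs ! i, vs ! Suc i} \<subseteq> es ! i)"

definition walk_joined :: "'a hypergraph \<Rightarrow> 'a \<Rightarrow> 'a \<Rightarrow> bool" where
  "walk_joined G u v \<longleftrightarrow> (\<exists>vs es. is_walk G vs es \<and> hd vs = u \<and> last vs = v)"

definition connected_hypergraph :: "'a hypergraph \<Rightarrow> bool" where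
  "connected_hypergraph G \<longleftrightarrow> (\<forall>u\<in>hverts G. \<forall>v\<in>hverts G. walk_joined G u v)"

definition hcomponents :: "'a hypergraph \<Rightarrow> 'a set set" where
  "hcomponents G = hverts G // {(u, v). walk_joined G u v}"

definition cyclomatic_number :: "nat \<Rightarrow> 'a hypergraph \<Rightarrow> int" where
  "cyclomatic_number k G =
     int (card (hedges G)) * (int k - 1) - int (card (hverts G)) + int (card (hcomponents G))"

definition bicyclic :: "nat \<Rightarrow> 'a hypergraph \<Rightarrow> bool" where
  "bicyclic k G \<longleftrightarrow> connected_hypergraph G \<and> cyclomatic_number k G = 2"

definition linear_bicyclic :: "nat \<Rightarrow> nat \<Rightarrow> 'a hypergraph \<Rightarrow> bool" where
  "linear_bicyclic k m G \<longleftrightarrow>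
     uniform_hypergraph k G \<and> linear_hypergraph G \<and> bicyclic k G \<and> card (hedges G) = m"

text \<open>Tensors of order \<open>k\<close> are functions on index lists of length \<open>k\<close>; the vertices
  themselves serve as indices. For a list of length \<open>k\<close>, membership of its set in the edge set
  of a \<open>k\<close>-uniform hypergraph forces its entries to be distinct.\<close>

definition adjacency_tensor :: "nat \<Rightarrow> 'a hypergraph \<Rightarrow> 'a list \<Rightarrow> complex" where
  "adjacency_tensor k G is = (if set is \<in> hedges G then 1 / fact (k - 1) else 0)"

definition tensor_eigenvalue ::
  "nat \<Rightarrow> 'a set \<Rightarrow> ('a list \<Rightarrow> complex) \<Rightarrow> complex \<Rightarrow> bool" where
  "tensor_eigenvalue k I T ev \<longleftrightarrow>
     (\<exists>x :: 'a \<Rightarrow> complex. (\<exists>i\<in>I. x i \<noteq> 0) \<and>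
        (\<forall>i\<in>I. (\<Sum>js | set js \<subseteq> I \<and> length js = k - 1. T (i # js) * prod_list (map x js))
               = ev * x i ^ (k - 1)))"

definition hypergraph_spectral_radius :: "nat \<Rightarrow> 'a hypergraph \<Rightarrow> real" where
  "hypergraph_spectral_radius k G =
     (GREATEST r. r \<in> norm ` {ev. tensor_eigenvalue k (hverts G) (adjacency_tensor k G) ev})"

text \<open>The extremal hypergraphs are only defined up to isomorphism, so each is rendered as an
  isomorphism-invariant predicate (\<open>is_\<dots>\<close>) with exactly one isomorphism class of models for
  given parameters.\<close>

definition is_hyperstar :: "nat \<Rightarrow> nat \<Rightarrow> 'a \<Rightarrow> 'a set set \<Rightarrow> bool" where
  "is_hyperstar k r u S \<longleftrightarrow>
     finite S \<and> card S = r \<and> (\<forall>e\<in>S. card e = k \<and> u \<in> e) \<and>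
     (\<forall>e\<in>S. \<forall>f\<in>S. e \<noteq> f \<longrightarrow> e \<inter> f = {u})"

text \<open>\<open>G'\<close> arises from \<open>G\<close> by attaching a \<open>k\<close>-uniform hyperstar with \<open>r\<close> edges, centred at
  \<open>u\<close>; for \<open>k = 2\<close> this attaches the star \<open>K\<^sub>1\<^sub>,\<^sub>r\<close>.\<close>

definition attach_hyperstar ::
  "nat \<Rightarrow> nat \<Rightarrow> 'a \<Rightarrow> 'a hypergraph \<Rightarrow> 'a hypergraph \<Rightarrow> bool" where
  "attach_hyperstar k r u G G' \<longleftrightarrow>
     u \<in> hverts G \<and>
     (\<exists>S. is_hyperstar k r u S \<and> (\<forall>e\<in>S. e \<inter> hverts G = {u}) \<and>
          hverts G' = hverts G \<union> \<Union>S \<and> hedges G' = hedges G \<union> S)"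

definition is_G5 :: "nat \<Rightarrow> 'a hypergraph \<Rightarrow> 'a \<Rightarrow> 'a \<Rightarrow> bool" where
  "is_G5 k G w v1 \<longleftrightarrow>
     uniform_hypergraph k G \<and> card (hedges G) = 4 \<and>
     (\<exists>e f1 f2 f3 v2 v3.
        hedges G = {e, f1, f2, f3} \<and>
        distinct [v1, v2, v3] \<and> {v1, v2, v3} \<subseteq> e \<and> w \<in> hverts G \<and> w \<notin> e \<and>
        f1 \<inter> e = {v1} \<and> f2 \<inter> e = {v2} \<and> f3 \<inter> e = {v3} \<and>
        f1 \<inter> f2 = {w} \<and> f1 \<inter> f3 = {w} \<and> f2 \<inter> f3 = {w} \<and>
        (\<forall>u \<in> hverts G - {v1, v2, v3, w}. hdegree G u = 1))"

definition is_BL1 :: "nat \<Rightarrow> nat \<Rightarrow> 'a hypergraph \<Rightarrow> bool" where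
  "is_BL1 k m G \<longleftrightarrow> (\<exists>G5 w v1. is_G5 k G5 w v1 \<and> attach_hyperstar k (m - 4) w G5 G)"

definition is_BL2 :: "nat \<Rightarrow> nat \<Rightarrow> 'a hypergraph \<Rightarrow> bool" where
  "is_BL2 k m G \<longleftrightarrow> (\<exists>G5 w v1. is_G5 k G5 w v1 \<and> attach_hyperstar k (m - 4) v1 G5 G)"

text \<open>\<open>G\<close> is the \<open>k\<close>-th power of the simple graph \<open>H\<close> (a 2-uniform hypergraph), \<open>N e\<close> being the
  set of new vertices added to the edge \<open>e\<close>.\<close>

definition is_power :: "nat \<Rightarrow> 'a hypergraph \<Rightarrow> 'a hypergraph \<Rightarrow> bool" where
  "is_power k H G \<longleftrightarrow>
     uniform_hypergraph 2 H \<and>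
     (\<exists>N :: 'a set \<Rightarrow> 'a set.
        (\<forall>e\<in>hedges H. finite (N e) \<and> card (N e) = k - 2 \<and> N e \<inter> hverts H = {}) \<and>
        (\<forall>e\<in>hedges H. \<forall>f\<in>hedges H. e \<noteq> f \<longrightarrow> N e \<inter> N f = {}) \<and>
        hverts G = hverts H \<union> (\<Union>e\<in>hedges H. N e) \<and>
        hedges G = (\<lambda>e. e \<union> N e) ` hedges H)"

definition is_K4_minus_edge :: "'a hypergraph \<Rightarrow> bool" where
  "is_K4_minus_edge H \<longleftrightarrow>
     card (hverts H) = 4 \<and>
     (\<exists>e. e \<subseteq> hverts H \<and> card e = 2 \<and>
          hedges H = {f. f \<subseteq> hverts H \<and> card f = 2} - {e})"

definition is_BP :: "nat \<Rightarrow> nat \<Rightarrow> 'a hypergraph \<Rightarrow> bool" where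
  "is_BP k m G \<longleftrightarrow>
     (\<exists>K u H. is_K4_minus_edge K \<and> u \<in> hverts K \<and> hdegree K u = 3 \<and>
              attach_hyperstar 2 (m - 5) u K H \<and> is_power k H G)"

end

theory Submission
  imports Defs "HOL-Analysis.Function_Topology"
begin

text \<open>
  The spectral radius is the maximum of \<open>k \<Sum>\<^sub>e \<Prod>\<^sub>v\<^sub>\<in>\<^sub>e x\<^sub>v\<close> over nonnegative \<open>x\<close> with
  \<open>\<Sum>\<^sub>v x\<^sub>v\<^sup>k = 1\<close>, and for a connected hypergraph the maximiser is a positive eigenvector. Hence moving
  an edge from a vertex \<open>v\<close> to a vertex \<open>u\<close> with \<open>x\<^sub>u \<ge> x\<^sub>v\<close> strictly increases the spectral radius.

  In an extremal hypergraph let \<open>u\<close> maximise \<open>x\<close>. No edge can be moved to \<open>u\<close>, so every edge avoiding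
  \<open>u\<close> meets the neighbourhood of \<open>u\<close> at least twice. Counting vertices leaves either a single such
  edge meeting it three times, which gives \<open>B\<^sup>L(1)\<close>, or two such edges meeting it twice each. Two
  disjoint edges could be improved by moving one onto a vertex of the other; two intersecting ones
  give \<open>B\<^sup>L(2)\<close> or \<open>B\<^sup>P\<close>, according to whether their other neighbours of \<open>u\<close> share an edge with \<open>u\<close>.
\<close>

subsection \<open>The variational characterisation of the spectral radius\<close>

text \<open>For a \<open>k\<close>-uniform edge set, \<open>k * edge_form E x\<close> is the
  degree-\<open>k\<close> form of the adjacency tensor: the \<open>k!\<close> orderings of an edge,
  each weighted by \<open>1/(k-1)!\<close>, contribute the factor \<open>k\<close>.\<close>

definition edge_form :: "'a set set \<Rightarrow> ('a \<Rightarrow> real) \<Rightarrow> real" where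
  "edge_form E x = (\<Sum>e\<in>E. \<Prod>v\<in>e. x v)"

lemma card_lists_of_set:
  assumes "finite A"
  shows "card {js. length js = card A \<and> set js = A} = fact (card A)"
proof -
  have "{js. length js = card A \<and> set js = A} =
        {js. length js = card A \<and> distinct js \<and> set js \<subseteq> A}"
    using assms by (metis (no_types, lifting) card_distinct card_subset_eq distinct_card order_refl)
  thus ?thesis
    using card_lists_distinct_length_eq[OF assms, of "card A"] by (simp add: fact_prod)
qed

text \<open>Group the index lists by the edge they form with \<open>i\<close>: each edge
  \<open>e\<close> at \<open>i\<close> arises from the \<open>(k-1)!\<close> orderings of
  \<open>e - {i}\<close>, which cancel the normalisation of the tensor.\<close>

lemma adjacency_tensor_apply:
  fixes x :: "'a \<Rightarrow> complex"
  assumes G: "uniform_hypergraph k G" and k: "k \<ge> 1" and i: "i \<in> hverts G"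
  shows "(\<Sum>js | set js \<subseteq> hverts G \<and> length js = k - 1.
            adjacency_tensor k G (i # js) * prod_list (map x js)) =
         (\<Sum>e | e \<in> hedges G \<and> i \<in> e. \<Prod>j\<in>e - {i}. x j)"
proof -
  let ?V = "hverts G" and ?T = "{e \<in> hedges G. i \<in> e}"
  have finV: "finite ?V" and E: "\<And>e. e \<in> hedges G \<Longrightarrow> e \<subseteq> ?V \<and> card e = k"
    using G by (auto simp: uniform_hypergraph_def)
  have finE: "finite (hedges G)"
    by (rule finite_subset[of _ "Pow ?V"]) (use E finV in auto)
  define J where "J = {js. set js \<subseteq> ?V \<and> length js = k - 1}"
  define J' where "J' = {js \<in> J. set (i # js) \<in> hedges G}"
  have finJ: "finite J" unfolding J_def using finV by (rule finite_lists_length_eq)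
  have finJ': "finite J'" using finJ by (simp add: J'_def)
  have "(\<Sum>js\<in>J. adjacency_tensor k G (i # js) * prod_list (map x js)) =
        (\<Sum>js\<in>J'. prod_list (map x js) / fact (k - 1))"
    by (rule sum.mono_neutral_cong_right) (use finJ in \<open>auto simp: J'_def adjacency_tensor_def\<close>)
  also have "\<dots> = (\<Sum>e\<in>?T. \<Sum>js\<in>{js \<in> J'. set (i # js) = e}. prod_list (map x js) / fact (k - 1))"
    by (rule sum.group[symmetric]) (use finJ' finE in \<open>auto simp: J'_def\<close>)
  also have "\<dots> = (\<Sum>e\<in>?T. \<Prod>j\<in>e - {i}. x j)"
  proof (rule sum.cong[OF refl])
    fix e assume e: "e \<in> ?T"
    have fe: "finite e" using e E finV finite_subset by blast
    have ce: "card (e - {i}) = k - 1" using e E by (auto simp: card_Diff_singleton)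
    have L: "{js \<in> J'. set (i # js) = e} = {js. length js = card (e - {i}) \<and> set js = e - {i}}"
    proof (intro set_eqI iffI)
      fix js assume js: "js \<in> {js \<in> J'. set (i # js) = e}"
      hence l: "length js = k - 1" and s: "insert i (set js) = e" by (auto simp: J'_def J_def)
      have "card e = k" using e E by auto
      \<comment> \<open>A repetition of \<open>i\<close> would leave \<open>k - 1\<close> list
        entries to cover all \<open>k\<close> vertices of \<open>e\<close>.\<close>
      have "i \<notin> set js"
      proof
        assume "i \<in> set js"
        hence "set js = e" using s by auto
        hence "k \<le> k - 1" using card_length[of js] l \<open>card e = k\<close> by simp
        thus False using k by simp
      qed
      thus "js \<in> {js. length js = card (e - {i}) \<and> set js = e - {i}}" using l s ce by auto
    next
      fix js assume "js \<in> {js. length js = card (e - {i}) \<and> set js = e - {i}}"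
      thus "js \<in> {js \<in> J'. set (i # js) = e}"
        using e E ce by (auto simp: J'_def J_def insert_absorb)
    qed
    have "prod_list (map x js) = (\<Prod>j\<in>e - {i}. x j)"
      if "length js = card (e - {i})" "set js = e - {i}" for js
      using that prod.distinct_set_conv_list[of js x] by (simp add: card_distinct)
    hence "(\<Sum>js\<in>{js \<in> J'. set (i # js) = e}. prod_list (map x js) / fact (k - 1)) =
          (\<Sum>js\<in>{js. length js = card (e - {i}) \<and> set js = e - {i}}.
             (\<Prod>j\<in>e - {i}. x j) / fact (k - 1))"
      unfolding L by (intro sum.cong) auto
    also have "\<dots> = (\<Prod>j\<in>e - {i}. x j)"
      using card_lists_of_set[of "e - {i}"] fe ce by simp
    finally show "(\<Sum>js\<in>{js \<in> J'. set (i # js) = e}. prod_list (map x js) / fact (k - 1)) =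
      (\<Prod>j\<in>e - {i}. x j)" .
  qed
  finally show ?thesis by (simp add: J_def)
qed

text \<open>Compactness yields a maximiser on the nonnegative part of the unit sphere of the
  \<open>k\<close>-norm. Both sides of the bound are homogeneous of degree \<open>k\<close>, so it
  extends to every nonnegative \<open>y\<close>.\<close>

lemma edge_form_maximizer_exists:
  fixes V :: "'a set"
  assumes V: "finite V" "V \<noteq> {}" and E: "\<And>e. e \<in> E \<Longrightarrow> e \<subseteq> V \<and> card e = k" and k: "k \<ge> 1"
  obtains x :: "'a \<Rightarrow> real" where "\<And>v. 0 \<le> x v" "(\<Sum>v\<in>V. x v ^ k) = 1"
    "\<And>y. (\<And>v. 0 \<le> y v) \<Longrightarrow> edge_form E y \<le> edge_form E x * (\<Sum>v\<in>V. y v ^ k)"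
proof -
  \<comment> \<open>Coordinates outside \<open>V\<close> are pinned to 0, so \<open>C\<close> is a
    product of compact sets over the whole type and Tychonoff's theorem applies.\<close>
  define C :: "('a \<Rightarrow> real) set" where "C = Pi\<^sub>E UNIV (\<lambda>v. if v \<in> V then {0..1} else {0})"
  define K where "K = C \<inter> {x. (\<Sum>v\<in>V. x v ^ k) = 1}"
  have "compactin (product_topology (\<lambda>_. euclidean) UNIV) C"
    unfolding C_def by (subst compactin_PiE) auto
  hence "compact C" by (simp add: euclidean_product_topology)
  moreover have "closed {x :: 'a \<Rightarrow> real. (\<Sum>v\<in>V. x v ^ k) = 1}"
    by (intro closed_Collect_eq continuous_intros continuous_on_product_coordinates)
  ultimately have K: "compact K" unfolding K_def by (rule compact_Int_closed)
  have cont: "continuous_on K (edge_form E)"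
    unfolding edge_form_def
    by (intro continuous_intros continuous_on_subset[OF continuous_on_product_coordinates]) auto
  obtain v0 where "v0 \<in> V" using V by blast
  have "(\<lambda>v. if v = v0 then 1 else 0) \<in> K"
    using V \<open>v0 \<in> V\<close> k by (simp add: K_def C_def PiE_iff if_distrib[of "\<lambda>z. z ^ k"] power_0_left sum.delta cong: if_cong)
  then obtain x where x: "x \<in> K" and xmax: "\<And>y. y \<in> K \<Longrightarrow> edge_form E y \<le> edge_form E x"
    using continuous_attains_sup[OF K _ cont] by blast
  have x0: "0 \<le> x v" for v
  proof -
    have "x v \<in> (if v \<in> V then {0..1} else {0})" using x by (auto simp: K_def C_def PiE_iff)
    thus ?thesis by (auto split: if_splits)
  qed
  have bound: "edge_form E y \<le> edge_form E x * (\<Sum>v\<in>V. y v ^ k)" if y: "\<And>v. 0 \<le> y v" for y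
  proof (cases "(\<Sum>v\<in>V. y v ^ k) = 0")
    \<comment> \<open>Such a \<open>y\<close> cannot be normalised, but it vanishes on
      \<open>V\<close>, and every edge is nonempty because \<open>k \<ge> 1\<close>.\<close>
    case True
    hence y0: "y v = 0" if "v \<in> V" for v
      using that V y k by (subst (asm) sum_nonneg_eq_0_iff) auto
    have "(\<Prod>v\<in>e. y v) = 0" if "e \<in> E" for e
    proof -
      have "finite e" "e \<noteq> {}" "e \<subseteq> V" using E[OF that] V k finite_subset by fastforce+
      thus ?thesis using y0 by (metis ex_in_conv prod_zero subsetD)
    qed
    thus ?thesis using True by (simp add: edge_form_def)
  next
    case False
    moreover have "(\<Sum>v\<in>V. y v ^ k) \<ge> 0" using y by (intro sum_nonneg) auto
    ultimately have pos: "(\<Sum>v\<in>V. y v ^ k) > 0" by linarith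
    define s where "s = root k (\<Sum>v\<in>V. y v ^ k)"
    have s: "s > 0" "s ^ k = (\<Sum>v\<in>V. y v ^ k)"
      unfolding s_def using pos k by (simp_all only: real_root_gt_0_iff real_root_pow_pos)
    define z where "z v = (if v \<in> V then y v / s else 0)" for v
    have z1: "(\<Sum>v\<in>V. z v ^ k) = 1"
    proof -
      have "(\<Sum>v\<in>V. z v ^ k) = (\<Sum>v\<in>V. y v ^ k / s ^ k)"
        by (intro sum.cong) (auto simp: z_def power_divide)
      also have "\<dots> = (\<Sum>v\<in>V. y v ^ k) / s ^ k" by (simp add: sum_divide_distrib)
      finally show ?thesis using s pos by simp
    qed
    have z0: "0 \<le> z v" for v using y s by (auto simp: z_def)
    have "z v \<le> 1" if "v \<in> V" for v
    proof -
      have "z v ^ k \<le> (\<Sum>v\<in>V. z v ^ k)" using that V z0 by (intro member_le_sum) auto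
      hence "z v ^ k \<le> 1 ^ k" using z1 by simp
      thus ?thesis using k power_mono_iff[of "z v" 1 k] z0 by auto
    qed
    hence "z \<in> K" using z0 z1 by (simp add: K_def C_def PiE_iff) (simp add: z_def)
    hence "edge_form E z \<le> edge_form E x" by (rule xmax)
    moreover have "edge_form E y = edge_form E z * s ^ k"
      unfolding edge_form_def sum_distrib_right
    proof (rule sum.cong[OF refl])
      fix e assume e: "e \<in> E"
      have "(\<Prod>v\<in>e. z v) * s ^ k = (\<Prod>v\<in>e. z v) * (\<Prod>v\<in>e. s)" using E[OF e] by simp
      also have "\<dots> = (\<Prod>v\<in>e. z v * s)" by (simp add: prod.distrib)
      also have "\<dots> = (\<Prod>v\<in>e. y v)" using E[OF e] s by (intro prod.cong) (auto simp: z_def)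
      finally show "(\<Prod>v\<in>e. y v) = (\<Prod>v\<in>e. z v) * s ^ k" by simp
    qed
    ultimately show ?thesis using s pos by (simp add: mult_right_mono)
  qed
  show ?thesis using that[of x] x0 bound x by (auto simp: K_def)
qed

text \<open>The Lagrange conditions: \<^const>\<open>edge_form\<close> is affine in each coordinate, so at a
  maximiser it suffices to differentiate a one-variable function.\<close>

lemma edge_form_maximizer_eigenvector:
  fixes x :: "'a \<Rightarrow> real"
  assumes V: "finite V" and finE: "finite E" and E: "\<And>e. e \<in> E \<Longrightarrow> finite e" and k: "k \<ge> 2"
    and bound: "\<And>y. (\<And>v. 0 \<le> y v) \<Longrightarrow> real k * edge_form E y \<le> r * (\<Sum>v\<in>V. y v ^ k)"
    and x0: "\<And>v. 0 \<le> x v" and eq: "real k * edge_form E x = r * (\<Sum>v\<in>V. x v ^ k)"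
    and i: "i \<in> V"
  shows "(\<Sum>e | e \<in> E \<and> i \<in> e. \<Prod>j\<in>e - {i}. x j) = r * x i ^ (k - 1)"
proof -
  define A where "A = (\<Sum>e | e \<in> E \<and> i \<in> e. \<Prod>j\<in>e - {i}. x j)"
  define B where "B = (\<Sum>e | e \<in> E \<and> i \<notin> e. \<Prod>j\<in>e. x j)"
  define D where "D = (\<Sum>v\<in>V - {i}. x v ^ k)"
  have form: "edge_form E (x(i := t)) = t * A + B" for t
  proof -
    have "edge_form E (x(i := t)) = (\<Sum>e | e \<in> E \<and> i \<in> e. \<Prod>j\<in>e. (x(i := t)) j) +
            (\<Sum>e | e \<in> E \<and> i \<notin> e. \<Prod>j\<in>e. (x(i := t)) j)"
      unfolding edge_form_def
      by (subst sum.union_disjoint[symmetric]) (use finE in \<open>auto intro: sum.cong\<close>)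
    also have "(\<Sum>e | e \<in> E \<and> i \<in> e. \<Prod>j\<in>e. (x(i := t)) j) = t * A"
      unfolding A_def sum_distrib_left
    proof (rule sum.cong[OF refl])
      fix e assume "e \<in> {e \<in> E. i \<in> e}"
      hence "(\<Prod>j\<in>e. (x(i := t)) j) = (x(i := t)) i * (\<Prod>j\<in>e - {i}. (x(i := t)) j)"
        using E by (intro prod.remove) auto
      also have "(\<Prod>j\<in>e - {i}. (x(i := t)) j) = (\<Prod>j\<in>e - {i}. x j)" by (intro prod.cong) auto
      finally show "(\<Prod>j\<in>e. (x(i := t)) j) = t * (\<Prod>j\<in>e - {i}. x j)" by simp
    qed
    also have "(\<Sum>e | e \<in> E \<and> i \<notin> e. \<Prod>j\<in>e. (x(i := t)) j) = B"
      unfolding B_def by (intro sum.cong prod.cong) auto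
    finally show ?thesis .
  qed
  have norm: "(\<Sum>v\<in>V. (x(i := t)) v ^ k) = t ^ k + D" for t
  proof -
    have "(\<Sum>v\<in>V. (x(i := t)) v ^ k) = (x(i := t)) i ^ k + (\<Sum>v\<in>V - {i}. (x(i := t)) v ^ k)"
      using V i by (intro sum.remove) auto
    also have "(\<Sum>v\<in>V - {i}. (x(i := t)) v ^ k) = D" unfolding D_def by (intro sum.cong) auto
    finally show ?thesis by simp
  qed
  \<comment> \<open>\<open>h\<close> is the slack of the bound along the line through
    \<open>x\<close> in direction \<open>i\<close>: it is nonnegative for \<open>t \<ge> 0\<close>
    and vanishes at \<open>t = x i\<close>, hence has a minimum there.\<close>
  define h where "h t = r * (t ^ k + D) - real k * (t * A + B)" for t
  have h0: "h t \<ge> 0" if "t \<ge> 0" for t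
    using bound[of "x(i := t)"] that x0 unfolding h_def form norm by simp
  have hx: "h (x i) = 0" using eq form[of "x i"] norm[of "x i"] by (simp add: h_def)
  have "A = r * x i ^ (k - 1)"
  proof (cases "x i = 0")
    \<comment> \<open>On the boundary only a one-sided comparison is available: dividing
      \<open>h t - h 0 \<ge> 0\<close> by \<open>t\<close> and letting \<open>t\<close> tend to 0
      from the right gives \<open>k * A \<le> 0\<close>.\<close>
    case True
    have "A \<ge> 0" unfolding A_def using x0 by (intro sum_nonneg prod_nonneg) auto
    moreover have "real k * A \<le> 0"
    proof -
      have "r * t ^ (k - 1) \<ge> real k * A" if t: "t > 0" for t
      proof -
        have "t * (r * t ^ (k - 1) - real k * A) = h t - h 0"
          using k power_minus_mult[of k t] by (simp add: h_def algebra_simps power_0_left)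
        also have "\<dots> \<ge> 0" using h0[of t] hx True t by simp
        finally show ?thesis using t by (simp add: zero_le_mult_iff)
      qed
      hence ev: "eventually (\<lambda>t. real k * A \<le> r * t ^ (k - 1)) (at_right 0)"
        by (auto simp: eventually_at_filter)
      have "((\<lambda>t. r * t ^ (k - 1)) \<longlongrightarrow> r * 0 ^ (k - 1)) (at_right 0)"
        by (intro tendsto_intros)
      hence "((\<lambda>t. r * t ^ (k - 1)) \<longlongrightarrow> 0) (at_right 0)" using k by (simp add: power_0_left)
      thus ?thesis using ev by (rule tendsto_lowerbound) auto
    qed
    ultimately have "A = 0" using k by (simp add: mult_le_0_iff)
    thus ?thesis using True k by simp
  next
    case False
    hence xi: "x i > 0" using x0[of i] by simp
    have "DERIV h (x i) :> r * (real k * x i ^ (k - 1)) - real k * A"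
      unfolding h_def by (auto intro!: derivative_eq_intros)
    moreover have "\<forall>t. \<bar>x i - t\<bar> < x i \<longrightarrow> h (x i) \<le> h t" using h0 hx by auto
    ultimately have "r * (real k * x i ^ (k - 1)) - real k * A = 0"
      using DERIV_local_min[of h _ "x i" "x i", OF _ xi] by blast
    thus ?thesis using k by (simp add: algebra_simps)
  qed
  thus ?thesis by (simp add: A_def)
qed

text \<open>If \<open>x\<close> vanished on a nonempty set \<open>Z\<close>, connectedness would
  give an edge meeting both \<open>Z\<close> and its complement. Raising the zeros to a small
  \<open>t\<close> gains at least order \<open>t ^ (k - 1)\<close> in the form, while the norm grows
  only by order \<open>t ^ k\<close>; this violates the bound.\<close>

lemma edge_form_maximizer_pos:
  fixes x :: "'a \<Rightarrow> real"
  assumes V: "finite V" and finE: "finite E" and E: "\<And>e. e \<in> E \<Longrightarrow> e \<subseteq> V \<and> card e = k"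
    and bound: "\<And>y. (\<And>v. 0 \<le> y v) \<Longrightarrow> real k * edge_form E y \<le> r * (\<Sum>v\<in>V. y v ^ k)"
    and x0: "\<And>v. 0 \<le> x v" and x1: "(\<Sum>v\<in>V. x v ^ k) = 1" and eq: "real k * edge_form E x = r"
    and k: "k \<ge> 1"
    and conn: "\<And>S. S \<subseteq> V \<Longrightarrow> S \<noteq> {} \<Longrightarrow> (\<forall>e\<in>E. e \<inter> S \<noteq> {} \<longrightarrow> e \<subseteq> S) \<Longrightarrow> S = V"
    and v: "v \<in> V"
  shows "x v > 0"
proof -
  define Z where "Z = {v \<in> V. x v = 0}"
  have "V - Z \<noteq> {}"
  proof
    assume "V - Z = {}"
    hence "(\<Sum>v\<in>V. x v ^ k) = 0" using k by (intro sum.neutral) (auto simp: Z_def)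
    thus False using x1 by simp
  qed
  have "\<forall>e\<in>E. e \<inter> (V - Z) \<noteq> {} \<longrightarrow> e \<subseteq> V - Z"
  proof (intro ballI impI, rule ccontr)
    fix e assume e: "e \<in> E" "e \<inter> (V - Z) \<noteq> {}" and "\<not> e \<subseteq> V - Z"
    hence eZ: "e \<inter> Z \<noteq> {}" using E by blast
    have fe: "finite e" and ce: "card e = k" and eV: "e \<subseteq> V"
      using E[OF e(1)] finite_subset[OF _ V] by auto
    define c where "c = (\<Prod>v\<in>e - Z. x v)"
    have xp: "x v > 0" if "v \<in> V - Z" for v
      using that x0[of v] by (auto simp: Z_def)
    have c: "c > 0" unfolding c_def using eV xp by (intro prod_pos) blast
    have j: "card (e \<inter> Z) \<le> k - 1"
    proof -
      have "e \<inter> Z \<subset> e" using e by blast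
      from psubset_card_mono[OF fe this] show ?thesis using ce by simp
    qed
    have r0: "r \<ge> 0" unfolding eq[symmetric] edge_form_def
      using x0 by (intro mult_nonneg_nonneg sum_nonneg prod_nonneg) auto
    \<comment> \<open>This is the bound at the perturbed vector \<open>y\<close>, divided by
      \<open>t ^ (k - 1)\<close>. Its right side tends to 0 with \<open>t\<close>, its left side is
      a positive constant.\<close>
    have le: "real k * c \<le> r * real (card Z) * t" if t: "0 < t" "t \<le> 1" for t
    proof -
      define y where "y v = (if v \<in> Z then t else x v)" for v
      have y0: "0 \<le> y v" and xy: "x v \<le> y v" for v using x0 t by (auto simp: y_def Z_def)
      have ye: "(\<Prod>v\<in>e. y v) = t ^ card (e \<inter> Z) * c"
      proof -
        have "(\<Prod>v\<in>e. y v) = (\<Prod>v\<in>e \<inter> Z. y v) * (\<Prod>v\<in>e - Z. y v)"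
          using prod.Int_Diff[OF fe] .
        moreover have "(\<Prod>v\<in>e - Z. y v) = c" unfolding c_def by (intro prod.cong) (auto simp: y_def)
        ultimately show ?thesis by (simp add: y_def)
      qed
      have xe: "(\<Prod>v\<in>e. x v) = 0" using eZ fe by (auto simp: Z_def)
      have "edge_form E x + t ^ card (e \<inter> Z) * c \<le> edge_form E y"
      proof -
        have "(\<Sum>e\<in>E - {e}. \<Prod>v\<in>e. x v) \<le> (\<Sum>e\<in>E - {e}. \<Prod>v\<in>e. y v)"
          using x0 xy by (intro sum_mono prod_mono) auto
        thus ?thesis unfolding edge_form_def sum.remove[OF finE e(1)] xe ye by simp
      qed
      hence "r + real k * (t ^ card (e \<inter> Z) * c) \<le> real k * edge_form E y"
        using mult_left_mono[of "edge_form E x + t ^ card (e \<inter> Z) * c" "edge_form E y" "real k"]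
        unfolding eq[symmetric] by (simp add: distrib_left)
      also have "\<dots> \<le> r * (\<Sum>v\<in>V. y v ^ k)" using y0 by (rule bound)
      also have "(\<Sum>v\<in>V. y v ^ k) = 1 + real (card Z) * t ^ k"
      proof -
        have "(\<Sum>v\<in>V. y v ^ k) = (\<Sum>v\<in>V. x v ^ k + (if v \<in> Z then t ^ k else 0))"
          using k by (intro sum.cong) (auto simp: y_def Z_def)
        also have "\<dots> = 1 + (\<Sum>v\<in>V \<inter> Z. t ^ k)"
          unfolding sum.distrib x1 using V by (simp only: sum.inter_restrict)
        also have "V \<inter> Z = Z" by (auto simp: Z_def)
        finally show ?thesis by simp
      qed
      finally have 1: "real k * (t ^ card (e \<inter> Z) * c) \<le> r * real (card Z) * t ^ k"
        by (simp add: algebra_simps)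
      have "t ^ (k - 1) \<le> t ^ card (e \<inter> Z)" using t j by (intro power_decreasing) auto
      hence "real k * c * t ^ (k - 1) \<le> real k * c * t ^ card (e \<inter> Z)"
        using c by (intro mult_left_mono) auto
      also have "\<dots> \<le> r * real (card Z) * t ^ k" using 1 by (simp add: mult_ac)
      also have "\<dots> = r * real (card Z) * t * t ^ (k - 1)"
        using k power_minus_mult[of k t] by (simp add: mult_ac)
      finally show ?thesis using t by simp
    qed
    have "eventually (\<lambda>t. real k * c \<le> r * real (card Z) * t) (at_right 0)"
      unfolding eventually_at_right[OF zero_less_one] using le by (intro exI[of _ 1]) simp
    moreover have "((\<lambda>t. r * real (card Z) * t) \<longlongrightarrow> r * real (card Z) * 0) (at_right 0)"
      by (intro tendsto_intros)
    ultimately have "real k * c \<le> r * real (card Z) * 0"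
      by (intro tendsto_lowerbound[of _ _ "at_right (0::real)"]) auto
    thus False using c k by (simp add: mult_le_0_iff)
  qed
  hence "V - Z = V" using \<open>V - Z \<noteq> {}\<close> by (intro conn) auto
  hence "x v \<noteq> 0" using v by (auto simp: Z_def)
  thus ?thesis using x0[of v] by simp
qed

text \<open>The Lagrange conditions at \<open>x\<close> make \<open>r\<close> an eigenvalue. For an
  arbitrary eigenvector \<open>z\<close>, take moduli in its equation at \<open>i\<close>, multiply
  by \<open>norm (z i)\<close> and sum over \<open>i\<close>: each edge is counted \<open>k\<close>
  times, and the bound at the vector of moduli gives \<open>norm ev \<le> r\<close>.\<close>

lemma spectral_radius_eq_maximum:
  fixes x :: "'a \<Rightarrow> real"
  assumes G: "uniform_hypergraph k G" and k: "k \<ge> 2"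
    and bound: "\<And>y. (\<And>v. 0 \<le> y v) \<Longrightarrow>
      real k * edge_form (hedges G) y \<le> r * (\<Sum>v\<in>hverts G. y v ^ k)"
    and x0: "\<And>v. 0 \<le> x v" and x1: "(\<Sum>v\<in>hverts G. x v ^ k) = 1"
    and eq: "real k * edge_form (hedges G) x = r"
  shows "hypergraph_spectral_radius k G = r"
proof -
  let ?V = "hverts G" and ?E = "hedges G"
  have V: "finite ?V" and E: "\<And>e. e \<in> ?E \<Longrightarrow> e \<subseteq> ?V \<and> card e = k"
    using G by (auto simp: uniform_hypergraph_def)
  have finE: "finite ?E" by (rule finite_subset[of _ "Pow ?V"]) (use E V in auto)
  have fe: "finite e" if "e \<in> ?E" for e using E[OF that] V finite_subset by blast
  have r0: "r \<ge> 0" unfolding eq[symmetric] edge_form_def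
    using x0 by (intro mult_nonneg_nonneg sum_nonneg prod_nonneg) auto
  have ev_iff: "tensor_eigenvalue k ?V (adjacency_tensor k G) ev \<longleftrightarrow>
      (\<exists>z. (\<exists>i\<in>?V. z i \<noteq> 0) \<and>
         (\<forall>i\<in>?V. (\<Sum>e | e \<in> ?E \<and> i \<in> e. \<Prod>j\<in>e - {i}. z j) = ev * z i ^ (k - 1)))" for ev
    using adjacency_tensor_apply[OF G] k unfolding tensor_eigenvalue_def by auto
  have "tensor_eigenvalue k ?V (adjacency_tensor k G) (of_real r)"
    unfolding ev_iff
  proof (intro exI[of _ "\<lambda>v. of_real (x v)"] conjI ballI)
    show "\<exists>i\<in>?V. complex_of_real (x i) \<noteq> 0"
    proof (rule ccontr)
      assume "\<not> ?thesis"
      hence "(\<Sum>v\<in>?V. x v ^ k) = 0" using k by (intro sum.neutral) auto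
      thus False using x1 by simp
    qed
    fix i assume "i \<in> ?V"
    hence "(\<Sum>e | e \<in> ?E \<and> i \<in> e. \<Prod>j\<in>e - {i}. x j) = r * x i ^ (k - 1)"
      using V finE fe k bound x0 eq x1 by (intro edge_form_maximizer_eigenvector) auto
    hence "complex_of_real (\<Sum>e | e \<in> ?E \<and> i \<in> e. \<Prod>j\<in>e - {i}. x j) =
           complex_of_real (r * x i ^ (k - 1))" by simp
    thus "(\<Sum>e | e \<in> ?E \<and> i \<in> e. \<Prod>j\<in>e - {i}. complex_of_real (x j)) =
          complex_of_real r * complex_of_real (x i) ^ (k - 1)" by simp
  qed
  moreover have "norm ev \<le> r" if ev: "tensor_eigenvalue k ?V (adjacency_tensor k G) ev" for ev
  proof -
    obtain z where z: "\<exists>i\<in>?V. z i \<noteq> 0" and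
      zeq: "\<And>i. i \<in> ?V \<Longrightarrow> (\<Sum>e | e \<in> ?E \<and> i \<in> e. \<Prod>j\<in>e - {i}. z j) = ev * z i ^ (k - 1)"
      using ev unfolding ev_iff by blast
    let ?y = "\<lambda>v. norm (z v)"
    have 1: "norm ev * ?y i ^ k \<le> (\<Sum>e\<in>?E. if i \<in> e then \<Prod>j\<in>e. ?y j else 0)" if i: "i \<in> ?V" for i
    proof -
      have "norm ev * ?y i ^ k = ?y i * norm (ev * z i ^ (k - 1))"
        using k power_minus_mult[of k "?y i"] by (simp add: norm_mult norm_power mult_ac)
      also have "\<dots> \<le> ?y i * (\<Sum>e | e \<in> ?E \<and> i \<in> e. \<Prod>j\<in>e - {i}. ?y j)"
        unfolding zeq[OF i, symmetric]
        by (intro mult_left_mono sum_norm_le) (auto simp: prod_norm)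
      also have "\<dots> = (\<Sum>e | e \<in> ?E \<and> i \<in> e. \<Prod>j\<in>e. ?y j)"
        unfolding sum_distrib_left using fe by (intro sum.cong) (auto simp: prod.remove)
      also have "\<dots> = (\<Sum>e\<in>?E. if i \<in> e then \<Prod>j\<in>e. ?y j else 0)"
        using finE by (intro sum.mono_neutral_cong_left) auto
      finally show ?thesis .
    qed
    have "norm ev * (\<Sum>i\<in>?V. ?y i ^ k) \<le> (\<Sum>i\<in>?V. \<Sum>e\<in>?E. if i \<in> e then \<Prod>j\<in>e. ?y j else 0)"
      unfolding sum_distrib_left by (intro sum_mono 1)
    also have "\<dots> = (\<Sum>e\<in>?E. \<Sum>i\<in>?V. if i \<in> e then \<Prod>j\<in>e. ?y j else 0)" by (rule sum.swap)
    also have "\<dots> = (\<Sum>e\<in>?E. real k * (\<Prod>j\<in>e. ?y j))"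
    proof (rule sum.cong[OF refl])
      fix e assume e: "e \<in> ?E"
      have "(\<Sum>i\<in>?V. if i \<in> e then \<Prod>j\<in>e. ?y j else 0) = (\<Sum>i\<in>?V \<inter> e. \<Prod>j\<in>e. ?y j)"
        using V by (intro sum.inter_restrict[symmetric])
      also have "?V \<inter> e = e" using E[OF e] by auto
      finally show "(\<Sum>i\<in>?V. if i \<in> e then \<Prod>j\<in>e. ?y j else 0) = real k * (\<Prod>j\<in>e. ?y j)"
        using E[OF e] by simp
    qed
    also have "\<dots> = real k * edge_form ?E ?y" by (simp add: edge_form_def sum_distrib_left)
    also have "\<dots> \<le> r * (\<Sum>i\<in>?V. ?y i ^ k)" by (rule bound) simp
    finally have "norm ev * (\<Sum>i\<in>?V. ?y i ^ k) \<le> r * (\<Sum>i\<in>?V. ?y i ^ k)" .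
    moreover have "(\<Sum>i\<in>?V. ?y i ^ k) > 0"
    proof -
      obtain i where "i \<in> ?V" "z i \<noteq> 0" using z by blast
      thus ?thesis using V by (intro sum_pos2[of _ i]) auto
    qed
    ultimately show ?thesis by simp
  qed
  moreover have "norm (complex_of_real r) = r" using r0 by simp
  ultimately have "r \<in> norm ` {ev. tensor_eigenvalue k ?V (adjacency_tensor k G) ev}"
    and "\<And>s. s \<in> norm ` {ev. tensor_eigenvalue k ?V (adjacency_tensor k G) ev} \<Longrightarrow> s \<le> r"
    by (metis imageI mem_Collect_eq, blast)
  thus ?thesis unfolding hypergraph_spectral_radius_def by (rule Greatest_equality)
qed

subsection \<open>Connectivity and linear bicyclic hypergraphs\<close>

text \<open>Inside the vertex set these are the unions of connected components. Stating connectivity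
  through them avoids rerouting walks when an edge is replaced.\<close>

definition edge_closed :: "'a set set \<Rightarrow> 'a set \<Rightarrow> bool" where
  "edge_closed E S \<longleftrightarrow> (\<forall>e\<in>E. e \<inter> S \<noteq> {} \<longrightarrow> e \<subseteq> S)"

lemma edge_closedD: "edge_closed E S \<Longrightarrow> e \<in> E \<Longrightarrow> a \<in> e \<Longrightarrow> a \<in> S \<Longrightarrow> b \<in> e \<Longrightarrow> b \<in> S"
  unfolding edge_closed_def by blast

lemma walk_joined_refl: "v \<in> hverts G \<Longrightarrow> walk_joined G v v"
  unfolding walk_joined_def is_walk_def by (intro exI[of _ "[v]"] exI[of _ "[]"]) auto

lemma walk_joined_step:
  assumes "walk_joined G u v" "e \<in> hedges G" "v \<in> e" "w \<in> e" "w \<in> hverts G"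
  shows "walk_joined G u w"
proof -
  obtain vs es where w: "is_walk G vs es" "hd vs = u" "last vs = v"
    using assms(1) unfolding walk_joined_def by blast
  have l: "length vs = Suc (length es)" using w by (simp add: is_walk_def)
  hence ne: "vs \<noteq> []" by auto
  have lst: "vs ! length es = v" using w l last_conv_nth[OF ne] by simp
  have "is_walk G (vs @ [w]) (es @ [e])"
    using w(1) assms lst by (auto simp: is_walk_def nth_append less_Suc_eq)
  thus ?thesis unfolding walk_joined_def using w ne
    by (intro exI[of _ "vs @ [w]"] exI[of _ "es @ [e]"]) auto
qed

lemma walk_joined_edge_closed:
  assumes "walk_joined G u v" "edge_closed (hedges G) S" "u \<in> S"
  shows "v \<in> S"
proof -
  obtain vs es where w: "is_walk G vs es" "hd vs = u" "last vs = v"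
    using assms(1) unfolding walk_joined_def by blast
  have l: "length vs = Suc (length es)" using w by (simp add: is_walk_def)
  hence ne: "vs \<noteq> []" by auto
  have "i \<le> length es \<Longrightarrow> vs ! i \<in> S" for i
  proof (induction i)
    case 0
    thus ?case using w ne assms(3) by (simp add: hd_conv_nth)
  next
    case (Suc i)
    hence "{vs ! i, vs ! Suc i} \<subseteq> es ! i" "es ! i \<in> hedges G" "vs ! i \<in> S"
      using w(1) by (auto simp: is_walk_def)
    thus ?case using edge_closedD[OF assms(2), of "es ! i" "vs ! i" "vs ! Suc i"] by auto
  qed
  hence "vs ! length es \<in> S" by simp
  thus ?thesis using w l last_conv_nth[OF ne] by simp
qed

lemma walk_joined_in_verts: "walk_joined G u v \<Longrightarrow> v \<in> hverts G"
  unfolding walk_joined_def is_walk_def by (metis Zero_not_Suc last_in_set list.size(3) subsetD)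

text \<open>Walks cannot leave an edge-closed set; conversely, the set of vertices reachable from
  \<open>u\<close> is edge-closed.\<close>

lemma connected_iff_edge_closed:
  assumes "uniform_hypergraph k G"
  shows "connected_hypergraph G \<longleftrightarrow>
    (\<forall>S. S \<subseteq> hverts G \<longrightarrow> S \<noteq> {} \<longrightarrow> edge_closed (hedges G) S \<longrightarrow> S = hverts G)"
proof
  assume conn: "connected_hypergraph G"
  show "\<forall>S. S \<subseteq> hverts G \<longrightarrow> S \<noteq> {} \<longrightarrow> edge_closed (hedges G) S \<longrightarrow> S = hverts G"
  proof (intro allI impI)
    fix S assume S: "S \<subseteq> hverts G" "S \<noteq> {}" "edge_closed (hedges G) S"
    obtain u where u: "u \<in> S" using S by blast
    have "v \<in> S" if "v \<in> hverts G" for v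
    proof -
      have "walk_joined G u v" using conn u S that unfolding connected_hypergraph_def by blast
      thus ?thesis using S(3) u by (rule walk_joined_edge_closed)
    qed
    thus "S = hverts G" using S by blast
  qed
next
  assume cl: "\<forall>S. S \<subseteq> hverts G \<longrightarrow> S \<noteq> {} \<longrightarrow> edge_closed (hedges G) S \<longrightarrow> S = hverts G"
  show "connected_hypergraph G"
    unfolding connected_hypergraph_def
  proof (intro ballI)
    fix u v assume u: "u \<in> hverts G" and v: "v \<in> hverts G"
    let ?S = "{v \<in> hverts G. walk_joined G u v}"
    have "edge_closed (hedges G) ?S"
      unfolding edge_closed_def
    proof (intro ballI impI)
      fix e assume e: "e \<in> hedges G" "e \<inter> ?S \<noteq> {}"
      then obtain a where a: "a \<in> e" "walk_joined G u a" by blast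
      have "e \<subseteq> hverts G" using assms e by (auto simp: uniform_hypergraph_def)
      thus "e \<subseteq> ?S" using walk_joined_step[OF a(2) e(1) a(1)] by blast
    qed
    moreover have "?S \<noteq> {}" using u walk_joined_refl[OF u] by auto
    ultimately have "?S = hverts G" by (intro cl[rule_format]) auto
    thus "walk_joined G u v" using v by blast
  qed
qed

lemma card_hcomponents_connected:
  assumes "connected_hypergraph G" "hverts G \<noteq> {}"
  shows "card (hcomponents G) = 1"
proof -
  have "{(u, v). walk_joined G u v} `` {u} = hverts G" if "u \<in> hverts G" for u
    using assms(1) that walk_joined_in_verts[of G u] by (auto simp: connected_hypergraph_def)
  hence "hcomponents G = {hverts G}"
    using assms(2) unfolding hcomponents_def quotient_def by auto
  thus ?thesis by simp
qed

text \<open>With a single component, cyclomatic number 2 turns into a vertex count, arranged here so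
  that the vertex number is not subtracted. Positivity of \<open>k\<close> and \<open>m\<close>
  guarantees a vertex, hence exactly one component rather than none.\<close>

lemma linear_bicyclic_iff:
  assumes "k \<ge> 1" "m \<ge> 1"
  shows "linear_bicyclic k m G \<longleftrightarrow>
    uniform_hypergraph k G \<and> linear_hypergraph G \<and> card (hedges G) = m \<and>
    card (hverts G) + 1 = m * (k - 1) \<and>
    (\<forall>S. S \<subseteq> hverts G \<longrightarrow> S \<noteq> {} \<longrightarrow> edge_closed (hedges G) S \<longrightarrow> S = hverts G)"
proof (cases "uniform_hypergraph k G \<and> card (hedges G) = m \<and> connected_hypergraph G")
  case True
  have "hedges G \<noteq> {}" using True assms by auto
  then obtain e where "e \<in> hedges G" by blast
  hence "hverts G \<noteq> {}" using True assms by (auto simp: uniform_hypergraph_def)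
  hence "card (hcomponents G) = 1" using True by (intro card_hcomponents_connected) auto
  hence "cyclomatic_number k G = 2 \<longleftrightarrow> int (card (hverts G) + 1) = int (m * (k - 1))"
    using True assms by (auto simp: cyclomatic_number_def of_nat_diff)
  thus ?thesis using True connected_iff_edge_closed[of k G]
    unfolding linear_bicyclic_def bicyclic_def of_nat_eq_iff by blast
next
  case False
  thus ?thesis using connected_iff_edge_closed[of k G]
    unfolding linear_bicyclic_def bicyclic_def by blast
qed

section \<open>Relabelling vertices, and existence of a Perron vector\<close>

lemma edge_form_image:
  assumes "inj_on \<phi> V" "\<And>e. e \<in> E \<Longrightarrow> e \<subseteq> V"
  shows "edge_form ((`) \<phi> ` E) y = edge_form E (y \<circ> \<phi>)"
proof -
  have "inj_on ((`) \<phi>) E" using inj_on_image_eq_iff[OF assms(1)] assms(2) by (auto simp: inj_on_def)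
  moreover have "(\<Prod>v\<in>\<phi> ` e. y v) = (\<Prod>v\<in>e. y (\<phi> v))" if "e \<in> E" for e
    using assms inj_on_subset[of \<phi> V e] that by (subst prod.reindex) auto
  ultimately show ?thesis unfolding edge_form_def by (subst sum.reindex) auto
qed

text \<open>Extremality in the theorem refers to competitors with vertices in \<open>nat\<close>;
  this allows a competitor over any vertex type to be copied there.\<close>

lemma linear_bicyclic_image:
  assumes lb: "linear_bicyclic k m G" and km: "k \<ge> 1" "m \<ge> 1" and inj: "inj_on \<phi> (hverts G)"
  shows "linear_bicyclic k m \<lparr>hverts = \<phi> ` hverts G, hedges = (`) \<phi> ` hedges G\<rparr>"
proof -
  let ?V = "hverts G" and ?E = "hedges G"
  note D = lb[unfolded linear_bicyclic_iff[OF km]]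
  have U: "finite ?V" "\<And>e. e \<in> ?E \<Longrightarrow> e \<subseteq> ?V \<and> card e = k"
    using D by (auto simp: uniform_hypergraph_def)
  have L: "\<And>e f. e \<in> ?E \<Longrightarrow> f \<in> ?E \<Longrightarrow> e \<noteq> f \<Longrightarrow> card (e \<inter> f) \<le> 1"
    using D unfolding linear_hypergraph_def by simp
  have c: "card ?E = m" "card ?V + 1 = m * (k - 1)" using D by auto
  have cl: "\<And>S. S \<subseteq> ?V \<Longrightarrow> S \<noteq> {} \<Longrightarrow> edge_closed ?E S \<Longrightarrow> S = ?V"
    using D by simp
  have injE: "inj_on ((`) \<phi>) ?E"
    using inj_on_image_eq_iff[OF inj] U(2) by (auto simp: inj_on_def)
  have ci: "card (\<phi> ` A) = card A" if "A \<subseteq> ?V" for A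
    using card_image[OF inj_on_subset[OF inj that]] .
  have "uniform_hypergraph k \<lparr>hverts = \<phi> ` ?V, hedges = (`) \<phi> ` ?E\<rparr>"
    using U ci by (auto simp: uniform_hypergraph_def)
  moreover have "linear_hypergraph \<lparr>hverts = \<phi> ` ?V, hedges = (`) \<phi> ` ?E\<rparr>"
    unfolding linear_hypergraph_def
  proof (clarsimp)
    fix e f assume ef: "e \<in> ?E" "f \<in> ?E" "\<phi> ` e \<noteq> \<phi> ` f"
    have "\<phi> ` e \<inter> \<phi> ` f = \<phi> ` (e \<inter> f)" using inj_on_image_Int[OF inj, of e f] U(2) ef by simp
    moreover have "e \<inter> f \<subseteq> ?V" using U ef by blast
    ultimately show "card (\<phi> ` e \<inter> \<phi> ` f) \<le> Suc 0" using L[of e f] ef ci by auto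
  qed
  moreover have "S = \<phi> ` ?V" if S: "S \<subseteq> \<phi> ` ?V" "S \<noteq> {}" "edge_closed ((`) \<phi> ` ?E) S" for S
  proof -
    let ?T = "{v \<in> ?V. \<phi> v \<in> S}"
    have "edge_closed ?E ?T"
      unfolding edge_closed_def
    proof (intro ballI impI)
      fix e assume e: "e \<in> ?E" "e \<inter> ?T \<noteq> {}"
      have "\<phi> ` e \<inter> S \<noteq> {}" using e by auto
      hence "\<phi> ` e \<subseteq> S" using S(3) e(1) unfolding edge_closed_def by simp
      thus "e \<subseteq> ?T" using U(2)[OF e(1)] by auto
    qed
    moreover have "?T \<noteq> {}" using S by blast
    ultimately have "?T = ?V" by (intro cl) auto
    thus ?thesis using S by blast
  qed
  ultimately show ?thesis
    unfolding linear_bicyclic_iff[OF km] using c ci card_image[OF injE] by auto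
qed

lemma perron_vector_exists:
  assumes G: "uniform_hypergraph k G" and k: "k \<ge> 2" and V: "hverts G \<noteq> {}"
  obtains x :: "'a \<Rightarrow> real" where "\<And>v. 0 \<le> x v" "(\<Sum>v\<in>hverts G. x v ^ k) = 1"
    "real k * edge_form (hedges G) x = hypergraph_spectral_radius k G"
    "\<And>y. (\<And>v. 0 \<le> y v) \<Longrightarrow>
       real k * edge_form (hedges G) y \<le> hypergraph_spectral_radius k G * (\<Sum>v\<in>hverts G. y v ^ k)"
proof -
  have fin: "finite (hverts G)" and E: "\<And>e. e \<in> hedges G \<Longrightarrow> e \<subseteq> hverts G \<and> card e = k"
    using G by (auto simp: uniform_hypergraph_def)
  show ?thesis
  proof (rule edge_form_maximizer_exists[OF fin V, of "hedges G" k])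
    fix x :: "'a \<Rightarrow> real"
    assume x: "\<And>v. 0 \<le> x v" "(\<Sum>v\<in>hverts G. x v ^ k) = 1"
      and max: "\<And>y. (\<And>v. 0 \<le> y v) \<Longrightarrow>
         edge_form (hedges G) y \<le> edge_form (hedges G) x * (\<Sum>v\<in>hverts G. y v ^ k)"
    have b: "real k * edge_form (hedges G) y \<le>
        real k * edge_form (hedges G) x * (\<Sum>v\<in>hverts G. y v ^ k)" if "\<And>v. 0 \<le> y v" for y
      using mult_left_mono[OF max[of y], of "real k"] that by (simp add: mult.assoc)
    have eq: "hypergraph_spectral_radius k G = real k * edge_form (hedges G) x"
      using G k b x by (intro spectral_radius_eq_maximum) auto
    show ?thesis
      by (rule that[of x]) (use x b in \<open>simp_all add: eq\<close>)
  qed (use E k in auto)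
qed

subsection \<open>Recognising the extremal hypergraphs\<close>

text \<open>\<open>W\<close> plays the role of the original vertices: an edge \<open>e\<close> is
  the graph edge \<open>e \<inter> W\<close> enlarged by \<open>e - W\<close>. Linearity keeps the
  traces distinct, since equal traces would put two common vertices into two different
  edges.\<close>

lemma is_power_of_trace:
  assumes uni: "uniform_hypergraph k G" and lin: "linear_hypergraph G"
    and W: "W \<subseteq> hverts G" "hverts G = W \<union> \<Union>(hedges G)"
    and two: "\<And>e. e \<in> hedges G \<Longrightarrow> card (e \<inter> W) = 2"
    and meet: "\<And>e f. e \<in> hedges G \<Longrightarrow> f \<in> hedges G \<Longrightarrow> e \<noteq> f \<Longrightarrow> e \<inter> f \<subseteq> W"
  shows "is_power k \<lparr>hverts = W, hedges = (\<lambda>e. e \<inter> W) ` hedges G\<rparr> G"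
proof -
  let ?E = "hedges G"
  have finV: "finite (hverts G)" and E: "\<And>e. e \<in> ?E \<Longrightarrow> e \<subseteq> hverts G \<and> card e = k"
    using uni by (auto simp: uniform_hypergraph_def)
  have fe: "finite e" if "e \<in> ?E" for e using E[OF that] finite_subset[OF _ finV] by simp
  have inj: "inj_on (\<lambda>e. e \<inter> W) ?E"
  proof (rule inj_onI, rule ccontr)
    fix e f assume ef: "e \<in> ?E" "f \<in> ?E" "e \<inter> W = f \<inter> W" "e \<noteq> f"
    have "card (e \<inter> W) \<le> card (e \<inter> f)" using ef fe[OF ef(1)] by (intro card_mono) auto
    moreover have "card (e \<inter> f) \<le> 1" using lin ef unfolding linear_hypergraph_def by simp
    ultimately show False using two[OF ef(1)] by simp
  qed
  \<comment> \<open>The edge is recovered from its trace \<open>h\<close>, and \<open>h\<close> is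
    then removed from it.\<close>
  define N where "N h = inv_into ?E (\<lambda>e. e \<inter> W) h - h" for h
  have N: "N (e \<inter> W) = e - W" if "e \<in> ?E" for e
    using inv_into_f_f[OF inj that] by (auto simp: N_def)
  have "card (e - W) = k - 2" if "e \<in> ?E" for e
    using card_Diff_subset_Int[of e W] fe[OF that] two[OF that] E[OF that] by simp
  moreover have "(e - W) \<inter> (f - W) = {}" if "e \<in> ?E" "f \<in> ?E" "e \<inter> W \<noteq> f \<inter> W" for e f
  proof -
    have "e \<noteq> f" using that by auto
    thus ?thesis using meet[of e f] that by auto
  qed
  moreover have "finite W" using W finite_subset finV by metis
  moreover have "(\<lambda>e. e \<union> N e) ` (\<lambda>e. e \<inter> W) ` ?E = ?E"
    unfolding image_image using N by (simp add: Int_Diff_Un cong: image_cong)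
  ultimately show ?thesis
    unfolding is_power_def uniform_hypergraph_def
    using two fe W(2) N by (intro conjI exI[of _ N]) auto
qed

text \<open>The centre \<open>c\<close> is left open between \<open>v1\<close> and \<open>w\<close>,
  so that both families built on \<open>G\<^sub>5\<close> are recognised by one lemma.\<close>

lemma attach_hyperstar_G5_exists:
  assumes uni: "uniform_hypergraph k G" and V: "hverts G = \<Union>(hedges G)"
    and sub: "{e, f1, f2, f3} \<subseteq> hedges G"
    and v: "distinct [v1, v2, v3]" "{v1, v2, v3} \<subseteq> e" and w: "w \<notin> e"
    and fe: "f1 \<inter> e = {v1}" "f2 \<inter> e = {v2}" "f3 \<inter> e = {v3}"
    and ff: "f1 \<inter> f2 = {w}" "f1 \<inter> f3 = {w}" "f2 \<inter> f3 = {w}"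
    and c: "c \<in> {v1, w}"
    and star: "\<And>g. g \<in> hedges G - {e, f1, f2, f3} \<Longrightarrow> g \<inter> (e \<union> f1 \<union> f2 \<union> f3) = {c}"
    and star2: "\<And>g h. g \<in> hedges G - {e, f1, f2, f3} \<Longrightarrow> h \<in> hedges G - {e, f1, f2, f3} \<Longrightarrow>
       g \<noteq> h \<Longrightarrow> g \<inter> h = {c}"
  shows "\<exists>G5. is_G5 k G5 w v1 \<and> attach_hyperstar k (card (hedges G) - 4) c G5 G"
proof -
  let ?E = "hedges G" and ?D = "{e, f1, f2, f3}"
  have finV: "finite (hverts G)" and E: "\<And>e. e \<in> ?E \<Longrightarrow> e \<subseteq> hverts G \<and> card e = k"
    using uni by (auto simp: uniform_hypergraph_def)
  have finE: "finite ?E" by (rule finite_subset[of _ "Pow (hverts G)"]) (use E finV in auto)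
  have wf: "w \<in> f1" "w \<in> f2" "w \<in> f3" using ff by auto
  have vf: "v1 \<in> f1" "v2 \<in> f2" "v3 \<in> f3" using fe by auto
  have dist: "e \<noteq> f1" "e \<noteq> f2" "e \<noteq> f3" "f1 \<noteq> f2" "f1 \<noteq> f3" "f2 \<noteq> f3"
    using w wf fe v(1) by auto
  hence cD: "card ?D = 4" by simp
  define K where "K = \<lparr>hverts = e \<union> f1 \<union> f2 \<union> f3, hedges = ?D\<rparr>"
  have KE: "hedges K = ?D" and KV: "hverts K = e \<union> f1 \<union> f2 \<union> f3" by (simp_all add: K_def)
  have deg: "hdegree K z = 1" if z: "z \<in> hverts K - {v1, v2, v3, w}" for z
  proof -
    \<comment> \<open>The four edges meet pairwise only in the named vertices, so any other vertex
      lies in exactly one of them.\<close>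
    have meet: "a \<inter> b \<subseteq> {v1, v2, v3, w}" if "a \<in> ?D" "b \<in> ?D" "a \<noteq> b" for a b
      using that fe ff Int_commute[of e] Int_commute[of f2 f1] Int_commute[of f3 f1]
        Int_commute[of f3 f2] by auto
    obtain a where a: "a \<in> ?D" "z \<in> a" using z by (auto simp: K_def)
    have "b = a" if "b \<in> ?D" "z \<in> b" for b
    proof (rule ccontr)
      assume "b \<noteq> a"
      from meet[OF that(1) a(1) this] show False using a that z by auto
    qed
    hence "{b \<in> hedges K. z \<in> b} = {a}" using a unfolding K_def hypergraph.simps by blast
    thus ?thesis by (simp add: hdegree_def)
  qed
  have "uniform_hypergraph k K"
    using sub E finite_subset[OF _ finV] by (auto simp: K_def uniform_hypergraph_def)
  moreover have "w \<in> hverts K" using wf KV by simp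
  moreover have "\<forall>z\<in>hverts K - {v1, v2, v3, w}. hdegree K z = 1" using deg by blast
  ultimately have "is_G5 k K w v1"
    unfolding is_G5_def KE
    using cD v w fe ff
    by (intro conjI, simp_all only:)
      (rule exI[of _ e], rule exI[of _ f1], rule exI[of _ f2], rule exI[of _ f3],
       rule exI[of _ v2], rule exI[of _ v3], simp)
  moreover have "attach_hyperstar k (card ?E - 4) c K G"
    unfolding attach_hyperstar_def
  proof (intro conjI exI[of _ "?E - ?D"])
    show "c \<in> hverts K" using c v wf by (auto simp: K_def)
    show "is_hyperstar k (card ?E - 4) c (?E - ?D)"
      unfolding is_hyperstar_def
    proof (intro conjI ballI impI)
      show "card (?E - ?D) = card ?E - 4" using sub cD finE by (simp add: card_Diff_subset)
    qed (use finE E star star2 in auto)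
    show "\<forall>g\<in>?E - ?D. g \<inter> hverts K = {c}" using star by (simp add: K_def)
    show "hverts G = hverts K \<union> \<Union>(?E - ?D)" using V sub by (auto simp: K_def)
    show "hedges G = hedges K \<union> (?E - ?D)" using sub by (auto simp: K_def)
  qed
  ultimately show ?thesis by blast
qed

subsection \<open>The structure of an extremal hypergraph\<close>

text \<open>Maximality is phrased as a bound on the form, for competitors on the same vertex set
  only: moving an edge leaves the vertex set unchanged, and spectral radii need not be mentioned
  again.\<close>

locale extremal_hypergraph =
  fixes k m :: nat and G :: "'a hypergraph" and x :: "'a \<Rightarrow> real" and r :: real
  assumes k3: "k \<ge> 3" and m5: "m \<ge> 5" and lb: "linear_bicyclic k m G"
    and x_nonneg: "\<And>v. 0 \<le> x v" and x_pos: "\<And>v. v \<in> hverts G \<Longrightarrow> 0 < x v"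
    and x_eq: "real k * edge_form (hedges G) x = r * (\<Sum>v\<in>hverts G. x v ^ k)"
    and maximal: "\<And>G' y. linear_bicyclic k m G' \<Longrightarrow> hverts G' = hverts G \<Longrightarrow> (\<And>v. 0 \<le> y v) \<Longrightarrow>
      real k * edge_form (hedges G') y \<le> r * (\<Sum>v\<in>hverts G. y v ^ k)"
begin

abbreviation "V \<equiv> hverts G"
abbreviation "E \<equiv> hedges G"

lemma km1: "k \<ge> 1" "m \<ge> 1" using k3 m5 by auto

lemma uniform: "uniform_hypergraph k G" using lb by (simp add: linear_bicyclic_def)
lemma finV: "finite V" using uniform by (simp add: uniform_hypergraph_def)
lemma edge_sub: "e \<in> E \<Longrightarrow> e \<subseteq> V" using uniform by (auto simp: uniform_hypergraph_def)
lemma card_edge: "e \<in> E \<Longrightarrow> card e = k" using uniform by (auto simp: uniform_hypergraph_def)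
lemma fin_edge: "e \<in> E \<Longrightarrow> finite e" using edge_sub finV finite_subset by blast
lemma finE: "finite E" by (rule finite_subset[of _ "Pow V"]) (use edge_sub finV in auto)
lemma cardE: "card E = m" using lb by (simp add: linear_bicyclic_def)
lemma cardV: "card V + 1 = m * (k - 1)" using lb unfolding linear_bicyclic_iff[OF km1] by simp

lemma closed_eq: "S \<subseteq> V \<Longrightarrow> S \<noteq> {} \<Longrightarrow> edge_closed E S \<Longrightarrow> S = V"
  using lb unfolding linear_bicyclic_iff[OF km1] by simp

lemma linear: "e \<in> E \<Longrightarrow> f \<in> E \<Longrightarrow> e \<noteq> f \<Longrightarrow> card (e \<inter> f) \<le> 1"
  using lb unfolding linear_bicyclic_def linear_hypergraph_def by simp

lemma meet_unique:
  assumes "e \<in> E" "f \<in> E" "e \<noteq> f" "a \<in> e" "a \<in> f" "b \<in> e" "b \<in> f"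
  shows "a = b"
  using linear[OF assms(1-3)] assms(4-) fin_edge[OF assms(1)]
  by (auto simp: card_le_Suc0_iff_eq)

text \<open>If \<open>x v \<le> x u\<close>, replacing \<open>v\<close> by \<open>u\<close> in the edge \<open>f\<close> does not decrease the form at the
  Perron vector \<open>x\<close>. So \<open>x\<close> is a Perron vector of the new hypergraph for the same value, but
  the eigenvector equation at \<open>u\<close> has gained a positive summand.\<close>

lemma no_improving_move:
  assumes f: "f \<in> E" "v \<in> f" and u: "u \<in> V" "u \<notin> f" and le: "x v \<le> x u"
    and disj: "\<And>g. g \<in> E \<Longrightarrow> u \<in> g \<Longrightarrow> g \<inter> (f - {v}) = {}"
    and conn: "\<And>S. edge_closed (E - {f}) S \<Longrightarrow> u \<in> S \<longleftrightarrow> v \<in> S"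
  shows False
proof -
  define f' where "f' = insert u (f - {v})"
  define E' where "E' = insert f' (E - {f})"
  define G' where "G' = \<lparr>hverts = V, hedges = E'\<rparr>"
  have ff: "finite f" using fin_edge f by blast
  have cf: "card (f - {v}) = k - 1" using f card_edge ff by simp
  have cf': "card f' = k" unfolding f'_def using cf ff u k3 by simp
  have "card (f - {v}) \<noteq> 0" using cf k3 by simp
  hence ne: "f - {v} \<noteq> {}" by (metis card.empty)
  \<comment> \<open>As an edge at \<open>u\<close>, \<open>f'\<close> would have to miss
    \<open>f - {v}\<close>, which is nonempty and contained in it.\<close>
  have f'E: "f' \<notin> E" using disj[of f'] ne by (auto simp: f'_def)
  have "uniform_hypergraph k G'"
    using finV edge_sub card_edge cf' f u by (auto simp: uniform_hypergraph_def G'_def E'_def f'_def)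
  moreover have "linear_hypergraph G'"
  proof -
    have *: "card (g \<inter> f') \<le> 1" if g: "g \<in> E" "g \<noteq> f" for g
    proof (cases "u \<in> g")
      case True
      hence "g \<inter> f' = {u}" using disj[OF g(1)] by (auto simp: f'_def)
      thus ?thesis by simp
    next
      case False
      hence "g \<inter> f' \<subseteq> g \<inter> f" by (auto simp: f'_def)
      hence "card (g \<inter> f') \<le> card (g \<inter> f)" using ff by (intro card_mono) auto
      thus ?thesis using linear g f by fastforce
    qed
    show ?thesis unfolding linear_hypergraph_def G'_def E'_def
      using * linear by (auto simp: Int_commute[of f'])
  qed
  moreover have "card E' = m" using f'E finE cardE f m5 by (simp add: E'_def)
  moreover have "S = V" if S: "S \<subseteq> V" "S \<noteq> {}" "edge_closed E' S" for S
  proof (rule closed_eq[OF S(1,2)])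
    have cl: "edge_closed (E - {f}) S" using S(3) by (auto simp: edge_closed_def E'_def)
    have clf: "f' \<inter> S \<noteq> {} \<Longrightarrow> f' \<subseteq> S" using S(3) by (auto simp: edge_closed_def E'_def)
    \<comment> \<open>By \<open>conn\<close>, \<open>S\<close> contains both or neither of
      \<open>u\<close> and \<open>v\<close>. So if \<open>f\<close> meets \<open>S\<close>, then
      \<open>f'\<close> does too, and \<open>f' \<subseteq> S\<close> brings in \<open>u\<close>,
      hence \<open>v\<close>.\<close>
    have "f \<subseteq> S" if "f \<inter> S \<noteq> {}"
      using that conn[OF cl] clf by (auto simp: f'_def)
    thus "edge_closed E S" using cl by (auto simp: edge_closed_def)
  qed
  ultimately have lb': "linear_bicyclic k m G'"
    unfolding linear_bicyclic_iff[OF km1] using cardV by (simp add: G'_def)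
  have max': "real k * edge_form E' y \<le> r * (\<Sum>v\<in>V. y v ^ k)" if "\<And>v. 0 \<le> y v" for y
    using maximal[OF lb', of y] that by (simp add: G'_def)
  have maxG: "real k * edge_form E y \<le> r * (\<Sum>v\<in>V. y v ^ k)" if "\<And>v. 0 \<le> y v" for y
    using maximal[OF lb, of y] that by simp
  have "edge_form E x = (\<Prod>w\<in>f. x w) + edge_form (E - {f}) x"
    unfolding edge_form_def using finE f by (intro sum.remove) auto
  moreover have "edge_form E' x = (\<Prod>w\<in>f'. x w) + edge_form (E - {f}) x"
    unfolding edge_form_def E'_def using finE f'E by (intro sum.insert) auto
  moreover have "(\<Prod>w\<in>f. x w) \<le> (\<Prod>w\<in>f'. x w)"
  proof -
    have "(\<Prod>w\<in>f. x w) = x v * (\<Prod>w\<in>f - {v}. x w)" using ff f by (intro prod.remove) auto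
    also have "\<dots> \<le> x u * (\<Prod>w\<in>f - {v}. x w)"
      using le x_nonneg by (intro mult_right_mono prod_nonneg) auto
    also have "\<dots> = (\<Prod>w\<in>f'. x w)" unfolding f'_def using ff u by (subst prod.insert) auto
    finally show ?thesis .
  qed
  ultimately have "edge_form E x \<le> edge_form E' x" by simp
  hence "real k * edge_form E x \<le> real k * edge_form E' x" by (simp add: mult_left_mono)
  hence eq': "real k * edge_form E' x = r * (\<Sum>v\<in>V. x v ^ k)"
    using max'[of x] x_nonneg x_eq by simp
  have finE': "finite E'" and fe': "\<And>e. e \<in> E' \<Longrightarrow> finite e"
    using finE fin_edge ff by (auto simp: E'_def f'_def)
  have "(\<Sum>e | e \<in> E' \<and> u \<in> e. \<Prod>j\<in>e - {u}. x j) = r * x u ^ (k - 1)"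
    using finV finE' fe' k3 max' x_nonneg eq' u
    by (intro edge_form_maximizer_eigenvector) auto
  moreover have "(\<Sum>e | e \<in> E \<and> u \<in> e. \<Prod>j\<in>e - {u}. x j) = r * x u ^ (k - 1)"
    using finV finE fin_edge k3 maxG x_nonneg x_eq u
    by (intro edge_form_maximizer_eigenvector) auto
  moreover have "{e \<in> E'. u \<in> e} = insert f' {e \<in> E. u \<in> e}"
    using u by (auto simp: E'_def f'_def)
  moreover have "(\<Sum>e\<in>insert f' {e \<in> E. u \<in> e}. \<Prod>j\<in>e - {u}. x j) =
      (\<Prod>j\<in>f' - {u}. x j) + (\<Sum>e | e \<in> E \<and> u \<in> e. \<Prod>j\<in>e - {u}. x j)"
    using finE f'E by (intro sum.insert) auto
  moreover have "(\<Prod>j\<in>f' - {u}. x j) > 0"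
    using edge_sub[OF f(1)] x_pos by (intro prod_pos) (auto simp: f'_def)
  ultimately show False by simp
qed

text \<open>There are no isolated vertices: the union of all edges is a nonempty edge-closed
  set.\<close>

lemma verts_eq: "V = \<Union>E"
proof -
  have "E \<noteq> {}" using cardE m5 by auto
  then obtain e where e: "e \<in> E" by blast
  hence "e \<noteq> {}" using card_edge k3 by fastforce
  hence "\<Union>E \<noteq> {}" using e by blast
  moreover have "edge_closed E (\<Union>E)" by (auto simp: edge_closed_def)
  ultimately show ?thesis using closed_eq[of "\<Union>E"] edge_sub by blast
qed

end

lemma pairs_of_four_minus_one:
  assumes "distinct [u, v, p, q]"
  shows "{f. f \<subseteq> {u, v, p, q} \<and> card f = 2} - {{p, q}} = {{u, v}, {u, p}, {u, q}, {v, p}, {v, q}}"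
proof (intro equalityI subsetI)
  fix f assume f: "f \<in> {f. f \<subseteq> {u, v, p, q} \<and> card f = 2} - {{p, q}}"
  then obtain a b where ab: "f = {a, b}" "a \<noteq> b" by (auto simp: card_2_iff)
  have "a \<in> {u, v, p, q}" "b \<in> {u, v, p, q}" and "{a, b} \<noteq> {p, q}" using f ab by auto
  thus "f \<in> {{u, v}, {u, p}, {u, q}, {v, p}, {v, q}}"
    unfolding ab(1) using ab(2) by (elim insertE emptyE) (simp_all add: doubleton_eq_iff)
next
  fix f assume "f \<in> {{u, v}, {u, p}, {u, q}, {v, p}, {v, q}}"
  thus "f \<in> {f. f \<subseteq> {u, v, p, q} \<and> card f = 2} - {{p, q}}"
    using assms by (elim insertE emptyE) (simp_all add: doubleton_eq_iff)
qed

section \<open>Edges avoiding a vertex of maximum Perron weight\<close>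

locale extremal_hypergraph_top = extremal_hypergraph +
  fixes u assumes u: "u \<in> V" and u_max: "\<And>v. v \<in> V \<Longrightarrow> x v \<le> x u"
begin

text \<open>This is the closed neighbourhood of \<open>u\<close> as soon as some edge contains
  \<open>u\<close>; the vertex counts below use \<open>insert u U\<close>, which covers every
  case.\<close>

definition "U = \<Union>{g \<in> E. u \<in> g}"
definition "F = {f \<in> E. u \<notin> f}"

lemma UE: assumes "a \<in> U" obtains g where "g \<in> E" "u \<in> g" "a \<in> g"
  using assms unfolding U_def by auto

lemma UI: "g \<in> E \<Longrightarrow> u \<in> g \<Longrightarrow> a \<in> g \<Longrightarrow> a \<in> U"
  unfolding U_def by auto

lemma FD: assumes "f \<in> F" shows "f \<in> E" "u \<notin> f"
  using assms by (auto simp: F_def)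

lemma edges_split: "E = {g \<in> E. u \<in> g} \<union> F" by (auto simp: F_def)

lemma finF: "finite F" using finE by (simp add: F_def)

text \<open>If \<open>v\<close> were the only vertex of \<open>f\<close> in \<open>U\<close>, then
  \<open>f\<close> could be moved from \<open>v\<close> to \<open>u\<close>: the edges at
  \<open>u\<close> miss \<open>f - {v}\<close>, and an edge through \<open>u\<close> and
  \<open>v\<close> keeps these two joined without \<open>f\<close>.\<close>

lemma edge_meets_U_not_once:
  assumes f: "f \<in> F" shows "f \<inter> U \<noteq> {v}"
proof
  assume fU: "f \<inter> U = {v}"
  hence v: "v \<in> f" "v \<in> U" by auto
  obtain g where g: "g \<in> E" "u \<in> g" "v \<in> g" using v UE by metis
  show False
  proof (rule no_improving_move[of f v u])
    show "f \<in> E" "u \<notin> f" using FD f by auto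
    show "x v \<le> x u" using u_max edge_sub g by auto
    show "h \<inter> (f - {v}) = {}" if "h \<in> E" "u \<in> h" for h
      using fU UI[OF that] by auto
    show "u \<in> S \<longleftrightarrow> v \<in> S" if "edge_closed (E - {f}) S" for S
    proof -
      have "g \<in> E - {f}" using g FD(2)[OF f] by auto
      thus ?thesis using edge_closedD[OF that] g by metis
    qed
  qed (use u v in auto)
qed

text \<open>Otherwise some edge \<open>e\<close> missing \<open>U\<close> meets, in a vertex
  \<open>v\<close>, an edge \<open>h\<close> of \<open>F\<close> that does reach \<open>U\<close>.
  Then \<open>e\<close> could be moved from \<open>v\<close> to \<open>u\<close>, since
  \<open>h\<close> and an edge at \<open>u\<close> still join \<open>v\<close> to
  \<open>u\<close>.\<close>

lemma edge_meets_U: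
  assumes f: "f \<in> F" shows "f \<inter> U \<noteq> {}"
proof
  assume fU: "f \<inter> U = {}"
  \<comment> \<open>These are the vertices within one further edge of \<open>U\<close>. Without a
    pair \<open>e\<close>, \<open>h\<close> as above, \<open>S\<close> would be edge-closed, hence
    all of \<open>V\<close>, although \<open>f\<close> misses \<open>U\<close>.\<close>
  define S where "S = insert u U \<union> \<Union>{h \<in> F. h \<inter> U \<noteq> {}}"
  have "\<exists>e h. e \<in> F \<and> e \<inter> U = {} \<and> h \<in> F \<and> h \<inter> U \<noteq> {} \<and> e \<inter> h \<noteq> {}"
  proof (rule ccontr)
    assume neg: "\<not> ?thesis"
    have "edge_closed E S"
      unfolding edge_closed_def
    proof (intro ballI impI)
      fix e assume e: "e \<in> E" "e \<inter> S \<noteq> {}"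
      show "e \<subseteq> S"
      proof (cases "u \<in> e")
        case True
        thus ?thesis using UI[OF e(1)] by (auto simp: S_def)
      next
        case False
        hence eF: "e \<in> F" using e by (simp add: F_def)
        have "e \<inter> U \<noteq> {}"
        proof
          assume "e \<inter> U = {}"
          then obtain h where "h \<in> F" "h \<inter> U \<noteq> {}" "e \<inter> h \<noteq> {}"
            using e False by (auto simp: S_def)
          thus False using neg eF \<open>e \<inter> U = {}\<close> by metis
        qed
        thus ?thesis using eF by (auto simp: S_def)
      qed
    qed
    moreover have "S \<subseteq> V" using u edge_sub by (auto simp: S_def U_def F_def)
    moreover have "S \<noteq> {}" by (simp add: S_def)
    ultimately have SV: "S = V" by (intro closed_eq)
    have "f \<noteq> {}" using card_edge[OF FD(1)[OF f]] k3 by auto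
    then obtain a where a: "a \<in> f" by auto
    hence "a \<in> S" using SV edge_sub[OF FD(1)[OF f]] by auto
    moreover have "a \<noteq> u" "a \<notin> U" using a FD(2)[OF f] fU by auto
    ultimately obtain h where h: "h \<in> F" "h \<inter> U \<noteq> {}" "a \<in> h" by (auto simp: S_def)
    hence "f \<inter> h \<noteq> {}" using a by auto
    thus False using neg f fU h(1,2) by metis
  qed
  then obtain e h where e: "e \<in> F" "e \<inter> U = {}" and h: "h \<in> F" "h \<inter> U \<noteq> {}"
    and eh: "e \<inter> h \<noteq> {}" by metis
  obtain v where v: "v \<in> e" "v \<in> h" using eh by auto
  obtain p where p: "p \<in> h" "p \<in> U" using h by auto
  obtain g where g: "g \<in> E" "u \<in> g" "p \<in> g" using p UE by metis
  have hE: "h \<in> E - {e}" using h e FD(1)[OF h(1)] by auto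
  have gE: "g \<in> E - {e}" using g FD(2)[OF e(1)] by auto
  show False
  proof (rule no_improving_move[of e v u])
    show "e \<in> E" "u \<notin> e" using FD e by auto
    show "x v \<le> x u" using u_max edge_sub[OF FD(1)[OF h(1)]] v by auto
    show "g \<inter> (e - {v}) = {}" if "g \<in> E" "u \<in> g" for g
      using e UI[OF that] by auto
    show "u \<in> S \<longleftrightarrow> v \<in> S" if "edge_closed (E - {e}) S" for S
      using edge_closedD[OF that hE] edge_closedD[OF that gE] g p v by metis
  qed (use u v in auto)
qed

lemma card_edge_meets_U:
  assumes f: "f \<in> F" shows "card (f \<inter> U) \<ge> 2"
proof -
  have fin: "finite (f \<inter> U)" using fin_edge FD f by simp
  hence "card (f \<inter> U) \<noteq> 0" using edge_meets_U[OF f] by simp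
  moreover have "card (f \<inter> U) \<noteq> 1"
    using edge_meets_U_not_once[OF f] by (metis card_1_singletonE)
  ultimately show ?thesis by linarith
qed

section \<open>Counting vertices around \<open>u\<close>\<close>

lemma card_insert_u_U: "card (insert u U) = 1 + card {g \<in> E. u \<in> g} * (k - 1)"
proof -
  define A where "A = (\<Union>g\<in>{g \<in> E. u \<in> g}. g - {u})"
  have A: "insert u U = insert u A" "u \<notin> A" "finite A"
    using finE fin_edge by (auto simp: A_def U_def)
  have "card A = (\<Sum>g\<in>{g \<in> E. u \<in> g}. card (g - {u}))"
    unfolding A_def
  proof (rule card_UN_disjoint)
    show "\<forall>g\<in>{g \<in> E. u \<in> g}. \<forall>h\<in>{g \<in> E. u \<in> g}. g \<noteq> h \<longrightarrow> (g - {u}) \<inter> (h - {u}) = {}"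
      using meet_unique by auto
  qed (use finE fin_edge in auto)
  also have "\<dots> = (\<Sum>g\<in>{g \<in> E. u \<in> g}. k - 1)"
    using card_edge fin_edge by (intro sum.cong) auto
  finally show ?thesis using A by simp
qed

text \<open>Split \<open>V\<close> into \<open>insert u U\<close> and what the edges of
  \<open>F\<close> add outside \<open>U\<close>. In the equation
  \<open>card V + 1 = m * (k - 1)\<close> the contribution of the edges at \<open>u\<close>
  cancels.\<close>

lemma card_F: "card F * (k - 1) = 2 + card (\<Union>f\<in>F. f - U)"
proof -
  have "V = insert u U \<union> (\<Union>f\<in>F. f - U)"
    using verts_eq u by (auto simp: U_def F_def)
  moreover have "insert u U \<inter> (\<Union>f\<in>F. f - U) = {}" by (auto simp: F_def)
  ultimately have "card V = card (insert u U) + card (\<Union>f\<in>F. f - U)"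
    using finV by (metis card_Un_disjoint finite_Un)
  moreover have "card E = card {g \<in> E. u \<in> g} + card F"
  proof -
    have "{g \<in> E. u \<in> g} \<inter> F = {}" by (auto simp: F_def)
    thus ?thesis using card_Un_disjoint[of "{g \<in> E. u \<in> g}" F] finE finF edges_split by simp
  qed
  ultimately show ?thesis
    using cardV cardE card_insert_u_U by (simp add: add_mult_distrib)
qed

lemma card_edge_minus_U:
  assumes "f \<in> F" shows "card (f - U) + card (f \<inter> U) = k"
  using card_Int_Diff[of f U] fin_edge card_edge FD(1)[OF assms] by simp

text \<open>Each edge of \<open>F\<close> has at most \<open>k - 2\<close> vertices outside
  \<open>U\<close>, so \<open>card_F\<close> leaves only one or two such edges; an empty
  \<open>F\<close> would give \<open>0 \<ge> 2\<close>.\<close>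

lemma F_cases:
  obtains (one) f where "F = {f}" "card (f \<inter> U) = 3"
  | (two) f1 f2 where "f1 \<noteq> f2" "F = {f1, f2}" "card (f1 \<inter> U) = 2" "card (f2 \<inter> U) = 2"
      "f1 \<inter> f2 \<subseteq> U"
proof -
  have "card (\<Union>f\<in>F. f - U) \<le> (\<Sum>f\<in>F. card (f - U))" using finF by (rule card_UN_le)
  also have "\<dots> \<le> (\<Sum>f\<in>F. k - 2)"
  proof (rule sum_mono)
    fix f assume "f \<in> F"
    thus "card (f - U) \<le> k - 2" using card_edge_minus_U[of f] card_edge_meets_U[of f] by linarith
  qed
  finally have "card F * (k - 1) \<le> 2 + card F * (k - 2)" using card_F by simp
  moreover have "k - 1 = Suc (k - 2)" using k3 by simp
  ultimately have "card F \<le> 2" by simp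
  moreover have "card F \<noteq> 0" using card_F by (metis add_is_0 mult_0 zero_neq_numeral)
  ultimately consider "card F = 1" | "card F = 2" by linarith
  thus thesis
  proof cases
    case 1
    then obtain f where f: "F = {f}" by (auto simp: card_1_singleton_iff)
    hence "card (f \<inter> U) = 3" using card_F card_edge_minus_U[of f] k3 by simp
    thus thesis using f one by simp
  next
    case 2
    then obtain f1 f2 where f: "F = {f1, f2}" "f1 \<noteq> f2" by (auto simp: card_2_iff)
    have fin: "finite (f1 - U)" "finite (f2 - U)" using fin_edge FD(1) f by auto
    have t: "card (f1 \<inter> U) \<ge> 2" "card (f2 \<inter> U) \<ge> 2" using card_edge_meets_U f by auto
    have c: "card (f1 - U) + card (f1 \<inter> U) = k" "card (f2 - U) + card (f2 \<inter> U) = k"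
      using card_edge_minus_U f by auto
    have "2 * (k - 1) = 2 + card ((f1 - U) \<union> (f2 - U))" using card_F f by simp
    moreover have "card (f1 - U) + card (f2 - U) =
        card ((f1 - U) \<union> (f2 - U)) + card ((f1 - U) \<inter> (f2 - U))"
      using fin by (rule card_Un_Int)
    \<comment> \<open>The union must have \<open>2 * (k - 2)\<close> elements, the largest size
      possible, so both sizes are extremal and the parts outside \<open>U\<close> are
      disjoint.\<close>
    ultimately have "card (f1 \<inter> U) = 2" "card (f2 \<inter> U) = 2" "card ((f1 - U) \<inter> (f2 - U)) = 0"
      using t c k3 by linarith+
    moreover from this have "(f1 - U) \<inter> (f2 - U) = {}" using fin by simp
    hence "f1 \<inter> f2 \<subseteq> U" by auto
    ultimately show thesis using two f by simp
  qed
qed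

text \<open>Move \<open>f2\<close> from \<open>q\<close> to \<open>p\<close>. By linearity
  \<open>gp\<close> is the only edge through both \<open>p\<close> and \<open>u\<close>, so the
  edges at \<open>p\<close> are among \<open>gp\<close> and \<open>f1\<close>, and both miss
  \<open>f2 - {q}\<close>; \<open>gp\<close> and \<open>gq\<close> keep \<open>p\<close> and
  \<open>q\<close> joined through \<open>u\<close>.\<close>

lemma disjoint_edges_no_move:
  assumes F: "F = {f1, f2}" and disj: "f1 \<inter> f2 = {}"
    and p: "p \<in> f1" "p \<in> gp" "gp \<in> E" "u \<in> gp" and q: "q \<in> f2" "q \<in> gq" "gq \<in> E" "u \<in> gq"
    and gp: "gp \<inter> (f2 - {q}) = {}" and le: "x q \<le> x p"
  shows False
proof (rule no_improving_move[of f2 q p])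
  have f2: "f2 \<in> E" "u \<notin> f2" using FD F by auto
  show "f2 \<in> E" by fact
  show "p \<in> V" using p edge_sub by auto
  show "p \<notin> f2" using p disj by auto
  show "g \<inter> (f2 - {q}) = {}" if g: "g \<in> E" "p \<in> g" for g
  proof (cases "u \<in> g")
    case True
    have "p \<noteq> u" using p FD(2)[of f1] F by auto
    hence "g = gp" using meet_unique[of g gp p u] g True p by metis
    thus ?thesis using gp by simp
  next
    case False
    hence "g \<in> F" using g by (simp add: F_def)
    hence "g = f1" using F g \<open>p \<notin> f2\<close> by auto
    thus ?thesis using disj by auto
  qed
  have "gp \<in> E - {f2}" "gq \<in> E - {f2}" using p q f2 by auto
  thus "p \<in> S \<longleftrightarrow> q \<in> S" if "edge_closed (E - {f2}) S" for S
    using edge_closedD[OF that] p q by metis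
qed (use q le in auto)

text \<open>For disjoint edges, \<open>p\<close> and \<open>q\<close> are chosen so that the move is
  admissible in both directions; comparing \<open>x p\<close> with \<open>x q\<close> decides which
  edge is moved.\<close>

lemma two_edges_meet:
  assumes F: "F = {f1, f2}"
  shows "f1 \<inter> f2 \<noteq> {}"
proof
  assume disj: "f1 \<inter> f2 = {}"
  have f: "f1 \<in> E" "u \<notin> f1" "f2 \<in> E" "u \<notin> f2" using FD F by auto
  have "\<exists>p q gp gq. p \<in> f1 \<and> p \<in> gp \<and> gp \<in> E \<and> u \<in> gp \<and> q \<in> f2 \<and> q \<in> gq \<and> gq \<in> E \<and> u \<in> gq \<and>
      gp \<inter> (f2 - {q}) = {} \<and> gq \<inter> (f1 - {p}) = {}"
  \<comment> \<open>If an edge at \<open>u\<close> meets both, it serves as \<open>gp\<close> and as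
    \<open>gq\<close>, since by linearity it meets each only once. If none does, any choice
    works.\<close>
  proof (cases "\<exists>g\<in>E. u \<in> g \<and> g \<inter> f1 \<noteq> {} \<and> g \<inter> f2 \<noteq> {}")
    case True
    then obtain g p q where g: "g \<in> E" "u \<in> g" and p: "p \<in> g" "p \<in> f1" and q: "q \<in> g" "q \<in> f2"
      by auto
    have "g \<inter> (f1 - {p}) = {}" using meet_unique[of g f1] g p f by auto
    moreover have "g \<inter> (f2 - {q}) = {}" using meet_unique[of g f2] g q f by auto
    ultimately show ?thesis using g p q by metis
  next
    case False
    obtain p q where p: "p \<in> f1" "p \<in> U" and q: "q \<in> f2" "q \<in> U"
      using edge_meets_U[of f1] edge_meets_U[of f2] F by auto
    obtain gp gq where gp: "gp \<in> E" "u \<in> gp" "p \<in> gp" and gq: "gq \<in> E" "u \<in> gq" "q \<in> gq"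
      using UE[OF p(2)] UE[OF q(2)] by metis
    have "gp \<inter> f2 = {}" using False gp p by auto
    moreover have "gq \<inter> f1 = {}" using False gq q by auto
    ultimately have "gp \<inter> (f2 - {q}) = {}" "gq \<inter> (f1 - {p}) = {}" by auto
    thus ?thesis using gp gq p q by metis
  qed
  then obtain p q gp gq where
    p: "p \<in> f1" "p \<in> gp" "gp \<in> E" "u \<in> gp" and q: "q \<in> f2" "q \<in> gq" "gq \<in> E" "u \<in> gq"
    and g: "gp \<inter> (f2 - {q}) = {}" "gq \<inter> (f1 - {p}) = {}" by metis
  show False
  proof (cases "x q \<le> x p")
    case True
    thus False using disjoint_edges_no_move[OF F disj p q g(1)] by simp
  next
    case False
    have "F = {f2, f1}" "f2 \<inter> f1 = {}" using F disj by auto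
    thus False using disjoint_edges_no_move[OF _ _ q p g(2)] False by simp
  qed
qed

section \<open>Reading off the extremal hypergraphs\<close>

lemma edges_at_u_meet: "g \<in> E \<Longrightarrow> h \<in> E \<Longrightarrow> u \<in> g \<Longrightarrow> u \<in> h \<Longrightarrow> g \<noteq> h \<Longrightarrow> g \<inter> h = {u}"
  using meet_unique by auto

lemma edges_meet_eq:
  assumes "g \<in> E" "h \<in> E" "g \<noteq> h" "a \<in> g" "a \<in> h" shows "g \<inter> h = {a}"
  using meet_unique[OF assms(1-3)] assms(4,5) by auto

text \<open>In \<open>G\<^sub>5\<close> the edge \<open>e\<close> is \<open>f\<close> and
  \<open>w\<close> is \<open>u\<close>; the \<open>f\<^sub>i\<close> are the edges joining
  \<open>u\<close> to the three vertices of \<open>f\<close> in \<open>U\<close>. They differ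
  because by linearity each meets \<open>f\<close> once, and all remaining edges form the hyperstar
  at \<open>u\<close>.\<close>

lemma BL1_if_one:
  assumes F: "F = {f}" and c: "card (f \<inter> U) = 3"
  shows "is_BL1 k m G"
proof -
  have f: "f \<in> E" "u \<notin> f" using FD F by auto
  obtain v1 v2 v3 where v: "f \<inter> U = {v1, v2, v3}" "distinct [v1, v2, v3]"
    using c by (auto simp: card_3_iff)
  have vf: "v1 \<in> f" "v2 \<in> f" "v3 \<in> f" and vU: "v1 \<in> U" "v2 \<in> U" "v3 \<in> U" using v by auto
  obtain g1 where g1: "g1 \<in> E" "u \<in> g1" "v1 \<in> g1" using UE vU by metis
  obtain g2 where g2: "g2 \<in> E" "u \<in> g2" "v2 \<in> g2" using UE vU by metis
  obtain g3 where g3: "g3 \<in> E" "u \<in> g3" "v3 \<in> g3" using UE vU by metis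
  have nf: "g1 \<noteq> f" "g2 \<noteq> f" "g3 \<noteq> f" using g1 g2 g3 f by auto
  have gf: "g1 \<inter> f = {v1}" "g2 \<inter> f = {v2}" "g3 \<inter> f = {v3}"
    using edges_meet_eq f g1 g2 g3 nf vf by metis+
  have ng: "g1 \<noteq> g2" "g1 \<noteq> g3" "g2 \<noteq> g3" using gf v(2) by auto
  have "\<exists>G5. is_G5 k G5 u v1 \<and> attach_hyperstar k (card E - 4) u G5 G"
  proof (rule attach_hyperstar_G5_exists[OF uniform verts_eq, of f g1 g2 g3 v1 v2 v3])
    show "g1 \<inter> g2 = {u}" "g1 \<inter> g3 = {u}" "g2 \<inter> g3 = {u}"
      using edges_at_u_meet g1 g2 g3 ng by metis+
    have rest: "h \<in> E" "u \<in> h" if "h \<in> E - {f, g1, g2, g3}" for h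
      using that F by (auto simp: F_def)
    show "h \<inter> (f \<union> g1 \<union> g2 \<union> g3) = {u}" if h: "h \<in> E - {f, g1, g2, g3}" for h
    proof -
      have "h \<inter> g1 = {u}" "h \<inter> g2 = {u}" "h \<inter> g3 = {u}"
        using edges_at_u_meet[of h] rest[OF h] h g1 g2 g3 by auto
      moreover have "h \<inter> f = {}"
      proof (rule ccontr)
        assume "h \<inter> f \<noteq> {}"
        then obtain a where a: "a \<in> h" "a \<in> f" by auto
        hence "a \<in> f \<inter> U" using UI rest[OF h] by auto
        hence "a \<in> {v1, v2, v3}" using v by simp
        hence "a \<in> g1 \<or> a \<in> g2 \<or> a \<in> g3" using g1 g2 g3 by auto
        hence "a = u" using calculation a by auto
        thus False using a f by simp
      qed
      ultimately show ?thesis by auto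
    qed
    show "h \<inter> h' = {u}" if "h \<in> E - {f, g1, g2, g3}" "h' \<in> E - {f, g1, g2, g3}" "h \<noteq> h'" for h h'
      using edges_at_u_meet rest that by metis
  qed (use f g1 g2 g3 v vf gf in auto)
  thus ?thesis unfolding is_BL1_def cardE by metis
qed

text \<open>The two edges of \<open>F\<close> meet in one vertex \<open>v\<close>, and
  \<open>p\<close>, \<open>q\<close> are their other neighbours of \<open>u\<close>. Linearity
  separates the edge \<open>g1\<close> through \<open>u\<close>, \<open>v\<close> from those through
  \<open>u\<close>, \<open>p\<close> and \<open>u\<close>, \<open>q\<close>; the outcome depends on
  whether the latter two coincide.\<close>

lemma BL2_or_BP_if_two:
  assumes ne: "f1 \<noteq> f2" and F: "F = {f1, f2}"
    and c: "card (f1 \<inter> U) = 2" "card (f2 \<inter> U) = 2" and sub: "f1 \<inter> f2 \<subseteq> U"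
  shows "is_BL2 k m G \<or> is_BP k m G"
proof -
  have f: "f1 \<in> E" "u \<notin> f1" "f2 \<in> E" "u \<notin> f2" using FD F by auto
  obtain v where v: "v \<in> f1" "v \<in> f2" using two_edges_meet[OF F] by auto
  have ff: "f1 \<inter> f2 = {v}" using edges_meet_eq f ne v by metis
  have vU: "v \<in> U" using v sub by auto
  have other: "\<exists>b. A = {v, b} \<and> b \<noteq> v" if A: "card A = 2" "v \<in> A" for A
  proof -
    obtain a b where ab: "A = {a, b}" "a \<noteq> b" using A(1) by (auto simp: card_2_iff)
    show ?thesis
    proof (cases "v = a")
      case True
      thus ?thesis using ab by auto
    next
      case False
      hence "A = {v, a}" "a \<noteq> v" using A ab by auto
      thus ?thesis by blast
    qed
  qed
  obtain p where p: "f1 \<inter> U = {v, p}" "p \<noteq> v" using other[OF c(1)] v vU by auto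
  obtain q where q: "f2 \<inter> U = {v, q}" "q \<noteq> v" using other[OF c(2)] v vU by auto
  have pf: "p \<in> f1" "p \<in> U" and qf: "q \<in> f2" "q \<in> U" using p q by auto
  have pnf: "p \<notin> f2" and qnf: "q \<notin> f1" using ff p q pf qf by auto
  obtain g1 where g1: "g1 \<in> E" "u \<in> g1" "v \<in> g1" using UE vU by metis
  obtain g2 where g2: "g2 \<in> E" "u \<in> g2" "p \<in> g2" using UE pf by metis
  obtain g3 where g3: "g3 \<in> E" "u \<in> g3" "q \<in> g3" using UE qf by metis
  have ngf: "g \<noteq> f1" "g \<noteq> f2" if "u \<in> g" for g using that f by auto
  have gf: "g1 \<inter> f1 = {v}" "g1 \<inter> f2 = {v}" "g2 \<inter> f1 = {p}" "g3 \<inter> f2 = {q}"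
    using edges_meet_eq f g1 g2 g3 ngf v pf qf by metis+
  have n12: "g1 \<noteq> g2" and n13: "g1 \<noteq> g3" using gf p q by auto
  have vu: "v \<noteq> u" "p \<noteq> u" "q \<noteq> u" "p \<noteq> q" using v f pf qf pnf by auto
  have vn: "v \<notin> g2" "v \<notin> g3"
    using edges_at_u_meet[of g1 g2] edges_at_u_meet[of g1 g3] g1 g2 g3 n12 n13 vu by auto
  have rest_u: "u \<in> h" if "h \<in> E" "h \<noteq> f1" "h \<noteq> f2" for h using that F by (auto simp: F_def)
  \<comment> \<open>Such an \<open>h\<close> can meet \<open>f1\<close> or \<open>f2\<close> only in
    \<open>U\<close>, that is in \<open>v\<close>, \<open>p\<close> or \<open>q\<close>, each
    already on another edge at \<open>u\<close>.\<close>
  have rest_f: "h \<inter> (f1 \<union> f2) = {}" if h: "h \<in> E" "u \<in> h" "h \<noteq> g1" "h \<noteq> g2" "h \<noteq> g3" for h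
  proof (rule ccontr)
    assume "h \<inter> (f1 \<union> f2) \<noteq> {}"
    then obtain a where a: "a \<in> h" "a \<in> f1 \<union> f2" by auto
    hence "a \<in> U" using UI h by auto
    hence "a \<in> {v, p, q}" using a p q by auto
    hence "a \<in> g1 \<or> a \<in> g2 \<or> a \<in> g3" using g1 g2 g3 by auto
    moreover have "h \<inter> g1 = {u}" "h \<inter> g2 = {u}" "h \<inter> g3 = {u}"
      using edges_at_u_meet[of h] h g1 g2 g3 by auto
    ultimately have "a = u" using a by auto
    thus False using a f by auto
  qed
  show ?thesis
  proof (cases "g2 = g3")
    case True
    \<comment> \<open>The roles change: \<open>v\<close> becomes the vertex of degree 3 of
      \<open>G\<^sub>5\<close>, \<open>g2\<close> the edge opposite to it, and \<open>u\<close>, now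
      in the place of \<open>v1\<close>, the centre of the hyperstar.\<close>
    have "\<exists>G5. is_G5 k G5 v u \<and> attach_hyperstar k (card E - 4) u G5 G"
    proof (rule attach_hyperstar_G5_exists[OF uniform verts_eq, of g2 g1 f1 f2 u p q])
      show "g1 \<inter> g2 = {u}" using edges_at_u_meet g1 g2 n12 by metis
      show "f1 \<inter> g2 = {p}" "f2 \<inter> g2 = {q}" using gf True by auto
      show "h \<inter> (g2 \<union> g1 \<union> f1 \<union> f2) = {u}" if h: "h \<in> E - {g2, g1, f1, f2}" for h
      proof -
        have hu: "u \<in> h" using rest_u h by auto
        hence "h \<inter> g2 = {u}" "h \<inter> g1 = {u}" using edges_at_u_meet[of h] h g1 g2 by auto
        moreover have "h \<inter> (f1 \<union> f2) = {}" using rest_f[of h] h hu True by auto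
        ultimately show ?thesis by auto
      qed
      show "h \<inter> h' = {u}" if "h \<in> E - {g2, g1, f1, f2}" "h' \<in> E - {g2, g1, f1, f2}" "h \<noteq> h'" for h h'
        using edges_at_u_meet[of h h'] rest_u[of h] rest_u[of h'] that by auto
    qed (use f g1 g2 g3 v vu vn gf ff True in auto)
    thus ?thesis unfolding is_BL2_def cardE by metis
  next
    case False
    hence n23: "g2 \<noteq> g3" .
    define S where "S = E - {g1, g2, g3, f1, f2}"
    \<comment> \<open>From each remaining edge at \<open>u\<close> one vertex other than
      \<open>u\<close> is selected as the leaf of the star in the underlying graph; the other
      \<open>k - 2\<close> are the added ones.\<close>
    define s where "s h = (SOME a. a \<in> h - {u})" for h :: "'a set"
    define K where "K = {u, v, p, q}"
    define W where "W = K \<union> s ` S"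
    have S: "h \<in> E" "u \<in> h" "h \<noteq> g1" "h \<noteq> g2" "h \<noteq> g3" if "h \<in> S" for h
      using that rest_u by (auto simp: S_def)
    have s: "s h \<in> h" "s h \<noteq> u" if "h \<in> S" for h
    proof -
      have "card (h - {u}) = k - 1" using S[OF that] card_edge fin_edge by simp
      hence "card (h - {u}) \<noteq> 0" using k3 by simp
      hence "h - {u} \<noteq> {}" by (metis card.empty)
      hence "s h \<in> h - {u}" unfolding s_def by (metis ex_in_conv someI_ex)
      thus "s h \<in> h" "s h \<noteq> u" by auto
    qed
    have gg: "g1 \<inter> g2 = {u}" "g1 \<inter> g3 = {u}" "g2 \<inter> g3 = {u}"
      using edges_at_u_meet g1 g2 g3 n12 n13 n23 by metis+
    have Sg: "h \<inter> g1 = {u}" "h \<inter> g2 = {u}" "h \<inter> g3 = {u}" "h \<inter> f1 = {}" "h \<inter> f2 = {}"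
      if "h \<in> S" for h
      using edges_at_u_meet[of h] S[OF that] g1 g2 g3 rest_f[of h] by auto
    have SS: "h \<inter> h' = {u}" if "h \<in> S" "h' \<in> S" "h \<noteq> h'" for h h'
      using edges_at_u_meet S that by metis
    have snot: "s h \<notin> g1" "s h \<notin> g2" "s h \<notin> g3" "s h \<notin> f1" "s h \<notin> f2" if "h \<in> S" for h
      using Sg[OF that] s[OF that] by auto
    have g3f: "g3 \<inter> f1 = {}" and g2f: "g2 \<inter> f2 = {}"
    proof -
      have "a \<in> {v, p} \<Longrightarrow> a \<notin> g3" for a using vn gg(3) g2 vu by auto
      moreover have "g3 \<inter> f1 \<subseteq> f1 \<inter> U" using UI g3 by auto
      ultimately show "g3 \<inter> f1 = {}" using p(1) by auto
      have "a \<in> {v, q} \<Longrightarrow> a \<notin> g2" for a using vn gg(3) g3 vu by auto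
      moreover have "g2 \<inter> f2 \<subseteq> f2 \<inter> U" using UI g2 by auto
      ultimately show "g2 \<inter> f2 = {}" using q(1) by auto
    qed
    have pq: "p \<notin> g1" "p \<notin> g3" "q \<notin> g1" "q \<notin> g2"
      using gg g2 g3 vu by auto
    have E_eq: "E = {g1, g2, g3, f1, f2} \<union> S" using g1 g2 g3 f by (auto simp: S_def)
    have trK: "g1 \<inter> K = {u, v}" "g2 \<inter> K = {u, p}" "g3 \<inter> K = {u, q}"
        "f1 \<inter> K = {v, p}" "f2 \<inter> K = {v, q}"
      using g1 g2 g3 v pf qf pq vn pnf qnf f by (auto simp: K_def)
    have tr: "g1 \<inter> W = {u, v}" "g2 \<inter> W = {u, p}" "g3 \<inter> W = {u, q}"
        "f1 \<inter> W = {v, p}" "f2 \<inter> W = {v, q}"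
      unfolding W_def Int_Un_distrib trK using snot by auto
    have SK: "h \<inter> K = {u}" if "h \<in> S" for h
      using Sg[OF that] S[OF that] g1 g2 g3 vu by (auto simp: K_def)
    have trS: "h \<inter> W = {u, s h}" if h: "h \<in> S" for h
    proof -
      have "a = s h" if a: "a \<in> h" "a \<in> s ` S" for a
      proof -
        obtain h' where h': "h' \<in> S" "a = s h'" using a by auto
        have "h = h'"
        proof (rule ccontr)
          assume "h \<noteq> h'"
          hence "h \<inter> h' = {u}" using SS h h' by metis
          moreover have "a \<in> h \<inter> h'" using a h' s(1) by auto
          ultimately show False using s(2) h' by auto
        qed
        thus ?thesis using h' by simp
      qed
      hence "h \<inter> s ` S \<subseteq> {s h}" by blast
      hence "h \<inter> s ` S = {s h}" using s(1)[OF h] imageI[OF h, of s] by blast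
      thus ?thesis unfolding W_def Int_Un_distrib using SK[OF h] by auto
    qed
    have core_sub_W: "{u, v, p, q} \<subseteq> W" by (auto simp: W_def K_def)
    have pair: "a \<inter> b \<subseteq> W" if ab: "a \<in> E" "b \<in> E" "a \<noteq> b" for a b
    proof -
      \<comment> \<open>By linearity a single common vertex in \<open>W\<close> is the whole
        intersection.\<close>
      have gen: "a \<inter> b \<subseteq> W" if "a \<in> E" "b \<in> E" "a \<noteq> b" "z \<in> a" "z \<in> b" "z \<in> W" for a b z
        using edges_meet_eq[of a b z] that by simp
      show ?thesis
      proof (cases "u \<in> a \<and> u \<in> b")
        case True
        thus ?thesis using gen[of a b u] ab core_sub_W by auto
      next
        case False
        hence "a \<in> F \<or> b \<in> F" using ab by (auto simp: F_def)
        moreover have "c \<inter> d \<subseteq> W" if c: "c \<in> F" and d: "d \<in> E" "d \<noteq> c" for c d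
        proof (cases "d \<in> F")
          case True
          hence "c \<inter> d = {v}" using c d F ff by auto
          thus ?thesis using core_sub_W by simp
        next
          case False
          hence "d \<subseteq> U" using d UI by (auto simp: F_def)
          hence "c \<inter> d \<subseteq> c \<inter> U" by auto
          also have "\<dots> \<subseteq> {u, v, p, q}" using c F p(1) q(1) by auto
          finally show ?thesis using core_sub_W by (rule order_trans)
        qed
        ultimately show ?thesis using ab Int_commute by metis
      qed
    qed
    define H where "H = \<lparr>hverts = W, hedges = (\<lambda>e. e \<inter> W) ` E\<rparr>"
    have "is_power k H G"
      unfolding H_def
    proof (rule is_power_of_trace[OF uniform])
      show "linear_hypergraph G" using lb by (simp add: linear_bicyclic_def)
      have "s h \<in> V" if "h \<in> S" for h using s(1)[OF that] edge_sub[OF S(1)[OF that]] by auto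
      moreover have "K \<subseteq> V" using u g1 g2 g3 edge_sub by (auto simp: K_def)
      ultimately show WV: "W \<subseteq> V" by (auto simp: W_def)
      thus "V = W \<union> \<Union>E" using verts_eq by auto
      fix e assume "e \<in> E"
      then consider "e \<in> {g1, g2, g3, f1, f2}" | "e \<in> S" using E_eq by auto
      thus "card (e \<inter> W) = 2"
      proof cases
        case 1
        thus ?thesis using tr vu p(2) q(2) by auto
      next
        case 2
        thus ?thesis using trS s(2)[of e] by auto
      qed
    qed (rule pair)
    \<comment> \<open>The missing edge is \<open>{p, q}\<close>, so \<open>u\<close> and
      \<open>v\<close> are the two vertices of degree 3.\<close>
    moreover define K4 where "K4 = \<lparr>hverts = K, hedges = {{u, v}, {u, p}, {u, q}, {v, p}, {v, q}}\<rparr>"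
    have dist: "u \<noteq> v" "u \<noteq> p" "u \<noteq> q" "v \<noteq> p" "v \<noteq> q" "p \<noteq> q" using vu p q by auto
    have "is_K4_minus_edge K4"
      unfolding is_K4_minus_edge_def
    proof (intro conjI exI[of _ "{p, q}"])
      show "card (hverts K4) = 4" using dist by (simp add: K4_def K_def)
      show "{p, q} \<subseteq> hverts K4" "card {p, q} = 2" using dist by (auto simp: K4_def K_def)
      show "hedges K4 = {f. f \<subseteq> hverts K4 \<and> card f = 2} - {{p, q}}"
        unfolding K4_def K_def hypergraph.simps using dist
        by (intro pairs_of_four_minus_one[symmetric]) simp
    qed
    moreover have "u \<in> hverts K4" by (simp add: K4_def K_def)
    moreover have "hdegree K4 u = 3"
    proof -
      have "{e \<in> hedges K4. u \<in> e} = {{u, v}, {u, p}, {u, q}}" using dist by (auto simp: K4_def)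
      thus ?thesis using dist by (simp add: hdegree_def doubleton_eq_iff)
    qed
    moreover have "attach_hyperstar 2 (m - 5) u K4 H"
      unfolding attach_hyperstar_def
    proof (intro conjI exI[of _ "(\<lambda>h. {u, s h}) ` S"])
      show "u \<in> hverts K4" by (simp add: K4_def K_def)
      have injs: "inj_on (\<lambda>h. {u, s h}) S"
      proof (rule inj_onI, rule ccontr)
        fix h h' assume h: "h \<in> S" "h' \<in> S" "{u, s h} = {u, s h'}" "h \<noteq> h'"
        hence "s h = s h'" using s(2) by (auto simp: doubleton_eq_iff)
        hence "s h \<in> h \<inter> h'" using s(1)[OF h(1)] s(1)[OF h(2)] by simp
        thus False using SS[OF h(1,2,4)] s(2)[OF h(1)] by simp
      qed
      have "card {g1, g2, g3, f1, f2} = 5" using n12 n13 n23 ngf g1 g2 g3 ne by auto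
      hence cS: "card S = m - 5" unfolding S_def
        using g1 g2 g3 f cardE by (subst card_Diff_subset) auto
      have finS: "finite S" using finE by (simp add: S_def)
      show "is_hyperstar 2 (m - 5) u ((\<lambda>h. {u, s h}) ` S)"
        unfolding is_hyperstar_def
      proof (intro conjI ballI impI)
        show "finite ((\<lambda>h. {u, s h}) ` S)" using finS by simp
        show "card ((\<lambda>h. {u, s h}) ` S) = m - 5" using card_image[OF injs] cS by simp
        show "card e = 2" "u \<in> e" if "e \<in> (\<lambda>h. {u, s h}) ` S" for e using that s(2)[THEN not_sym] by auto
        show "e \<inter> e' = {u}" if "e \<in> (\<lambda>h. {u, s h}) ` S" "e' \<in> (\<lambda>h. {u, s h}) ` S" "e \<noteq> e'" for e e'
          using that by auto
      qed
      show "\<forall>e\<in>(\<lambda>h. {u, s h}) ` S. e \<inter> hverts K4 = {u}"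
      proof
        fix e assume "e \<in> (\<lambda>h. {u, s h}) ` S"
        then obtain h where h: "h \<in> S" "e = {u, s h}" by auto
        have "s h \<notin> K" using SK[OF h(1)] s[OF h(1)] by auto
        thus "e \<inter> hverts K4 = {u}" using h by (auto simp: K4_def K_def)
      qed
      show "hverts H = hverts K4 \<union> \<Union>((\<lambda>h. {u, s h}) ` S)"
        by (auto simp: H_def W_def K4_def K_def)
      have "(\<lambda>e. e \<inter> W) ` S = (\<lambda>h. {u, s h}) ` S" using trS by (rule image_cong[OF refl])
      thus "hedges H = hedges K4 \<union> (\<lambda>h. {u, s h}) ` S"
        unfolding H_def K4_def hypergraph.simps by (subst E_eq) (simp add: tr)
    qed
    ultimately show ?thesis unfolding is_BP_def by metis
  qed
qed

lemma extremal_structure: "is_BL1 k m G \<or> is_BL2 k m G \<or> is_BP k m G"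
proof (cases rule: F_cases)
  case (one f)
  thus ?thesis using BL1_if_one by simp
next
  case (two f1 f2)
  thus ?thesis using BL2_or_BP_if_two by simp
qed

end

section \<open>From spectral maximality to the structural argument\<close>

theorem theorem3p9:
  fixes k m :: nat and G :: "'a hypergraph"
  assumes "k \<ge> 3" and "m \<ge> 5"
    and "linear_bicyclic k m G"
    and "\<And>G' :: nat hypergraph. linear_bicyclic k m G' \<Longrightarrow>
           hypergraph_spectral_radius k G' \<le> hypergraph_spectral_radius k G"
  shows "is_BL1 k m G \<or> is_BL2 k m G \<or> is_BP k m G"
proof -
  let ?V = "hverts G" and ?E = "hedges G" and ?r = "hypergraph_spectral_radius k G"
  have km: "k \<ge> 1" "m \<ge> 1" "k \<ge> 2" using assms(1,2) by auto
  note D = assms(3)[unfolded linear_bicyclic_iff[OF km(1,2)]]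
  have uni: "uniform_hypergraph k G" using D by simp
  have finV: "finite ?V" and E: "\<And>e. e \<in> ?E \<Longrightarrow> e \<subseteq> ?V \<and> card e = k"
    using uni by (auto simp: uniform_hypergraph_def)
  have finE: "finite ?E" by (rule finite_subset[of _ "Pow ?V"]) (use E finV in auto)
  have cV: "card ?V + 1 = m * (k - 1)" using D by simp
  have "5 * 2 \<le> m * (k - 1)" using assms(1,2) by (intro mult_le_mono) auto
  hence V: "?V \<noteq> {}" using cV by auto
  obtain \<phi> :: "'a \<Rightarrow> nat" where inj: "inj_on \<phi> ?V"
    using finite_imp_inj_to_nat_seg[OF finV] by auto
  \<comment> \<open>A competitor on the vertices of \<open>G\<close> is copied into
    \<open>nat\<close> along \<open>\<phi>\<close>, where the extremality hypothesis applies;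
    \<open>z\<close> carries \<open>y\<close> along, so form and norm are unchanged.\<close>
  have maximal: "real k * edge_form (hedges G') y \<le> ?r * (\<Sum>v\<in>?V. y v ^ k)"
    if lb': "linear_bicyclic k m G'" and V': "hverts G' = ?V" and y: "\<And>v. 0 \<le> y v"
    for G' :: "'a hypergraph" and y :: "'a \<Rightarrow> real"
  proof -
    define G'' where "G'' = \<lparr>hverts = \<phi> ` ?V, hedges = (`) \<phi> ` hedges G'\<rparr>"
    have lb'': "linear_bicyclic k m G''"
      using linear_bicyclic_image[OF lb' km(1,2), of \<phi>] inj V' by (simp add: G''_def)
    have uni'': "uniform_hypergraph k G''" using lb'' by (simp add: linear_bicyclic_def)
    have V'': "hverts G'' \<noteq> {}" using V by (simp add: G''_def)
    have sub: "e \<subseteq> ?V" if "e \<in> hedges G'" for e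
      using lb' V' that by (auto simp: linear_bicyclic_def uniform_hypergraph_def)
    define z where "z n = y (inv_into ?V \<phi> n)" for n
    have z: "z (\<phi> v) = y v" if "v \<in> ?V" for v using inv_into_f_f[OF inj that] by (simp add: z_def)
    have "edge_form (hedges G'') z = edge_form (hedges G') (z \<circ> \<phi>)"
      unfolding G''_def hypergraph.simps using inj sub by (rule edge_form_image)
    also have "\<dots> = edge_form (hedges G') y"
      unfolding edge_form_def using sub z by (intro sum.cong prod.cong) auto
    finally have form: "edge_form (hedges G'') z = edge_form (hedges G') y" .
    have "(\<Sum>n\<in>hverts G''. z n ^ k) = (\<Sum>v\<in>?V. z (\<phi> v) ^ k)"
      by (simp add: G''_def sum.reindex[OF inj])
    also have "\<dots> = (\<Sum>v\<in>?V. y v ^ k)" using z by (intro sum.cong) auto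
    finally have pow: "(\<Sum>n\<in>hverts G''. z n ^ k) = (\<Sum>v\<in>?V. y v ^ k)" .
    have "real k * edge_form (hedges G'') z \<le>
        hypergraph_spectral_radius k G'' * (\<Sum>n\<in>hverts G''. z n ^ k)"
    proof (rule perron_vector_exists[OF uni'' km(3) V''])
      fix x' :: "nat \<Rightarrow> real"
      assume b: "\<And>w. (\<And>v. 0 \<le> w v) \<Longrightarrow> real k * edge_form (hedges G'') w \<le>
        hypergraph_spectral_radius k G'' * (\<Sum>n\<in>hverts G''. w n ^ k)"
      show ?thesis by (rule b) (simp add: z_def y)
    qed
    also have "\<dots> \<le> ?r * (\<Sum>n\<in>hverts G''. z n ^ k)"
      using assms(4)[OF lb''] y by (intro mult_right_mono sum_nonneg) (auto simp: z_def)
    finally show ?thesis unfolding form pow .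
  qed
  show ?thesis
  proof (rule perron_vector_exists[OF uni km(3) V])
    fix x :: "'a \<Rightarrow> real"
    assume x0: "\<And>v. 0 \<le> x v" and x1: "(\<Sum>v\<in>?V. x v ^ k) = 1"
      and eq: "real k * edge_form ?E x = ?r"
      and b: "\<And>y. (\<And>v. 0 \<le> y v) \<Longrightarrow> real k * edge_form ?E y \<le> ?r * (\<Sum>v\<in>?V. y v ^ k)"
    have pos: "0 < x v" if "v \<in> ?V" for v
    proof (rule edge_form_maximizer_pos[OF finV finE E b x0 x1 eq km(1) _ that])
      show "S = ?V" if "S \<subseteq> ?V" "S \<noteq> {}" "\<forall>e\<in>?E. e \<inter> S \<noteq> {} \<longrightarrow> e \<subseteq> S" for S
        using D that by (simp add: edge_closed_def)
    qed
    interpret extremal_hypergraph k m G x ?r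
      by unfold_locales (use assms(1-3) x0 pos eq x1 maximal in auto)
    have "Max (x ` ?V) \<in> x ` ?V" using finV V by (intro Max_in) auto
    then obtain u where u: "u \<in> ?V" "x u = Max (x ` ?V)" by auto
    have umax: "x v \<le> x u" if "v \<in> ?V" for v using that finV u by simp
    interpret extremal_hypergraph_top k m G x ?r u
      by unfold_locales (use u umax in auto)
    show ?thesis by (rule extremal_structure)
  qed
qed

end
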